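(* Let $W$ be a finite Weyl group of irreducible type, with simple reflections $s_1,\dots,s_n$ and simple roots $\alpha_1,\dots,\alpha_n$ labelled as in the context, and for a positive root $\alpha$ let $s_\alpha\in W$ be the associated reflection. In each type below, every listed equality holds in $W$. The right-hand side of each is a palindromic word in the simple reflections and is a reduced expression. The list for a given type contains exactly one expression for each distinct reflection of $W$ (equivalently, for each positive root). **($A_n$, $n\ge 1$)** For $1\le i\le j\le n$: $$s_{e_i-e_{j+1}} = s_is_{i+1}\cdots s_{j-1}s_js_{j-1}\cdots s_{i+1}s_i .$$ **($B_n$, $n\ge 2$)** For $1\le i<j\le n$ (and, in the third formula, for all $1\le i\le n$): $$s_{e_i-e_j}=s_is_{i+1}\cdots s_{j-2}s_{j-1}s_{j-2}\cdots s_{i+1}s_i,$$ $$s_{e_i+e_j}=(s_js_{j+1}\cdots s_{n-1}\cdot s_is_{i+1}\cdots s_{n-2})(s_ns_{n-1}s_n)(s_{n-2}\cdots s_{i+1}s_i\cdot s_{n-1}\cdots s_{j+1}s_j),$$ $$s_{e_i}=s_is_{i+1}\cdots s_{n-1}s_ns_{n-1}\cdots s_{i+1}s_i .$$ **($C_n$, $n\ge 2$)** For $1\le i<j\le n$ (and, in the third formula, for all $1\le i\le n$): $$s_{e_i-e_j}=s_is_{i+1}\cdots s_{j-2}s_{j-1}s_{j-2}\cdots s_{i+1}s_i,$$ $$s_{e_i+e_j}=(s_js_{j+1}\cdots s_{n-1}\cdot s_is_{i+1}\cdots s_{n-2})(s_ns_{n-1}s_n)(s_{n-2}\cdots s_{i+1}s_i\cdot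 s_{n-1}\cdots s_{j+1}s_j),$$ $$s_{2e_i}=s_is_{i+1}\cdots s_{n-1}s_ns_{n-1}\cdots s_{i+1}s_i .$$ **($D_n$, $n\ge 4$)** $$s_{e_i-e_j}=s_is_{i+1}\cdots s_{j-2}s_{j-1}s_{j-2}\cdots s_{i+1}s_i\quad (1\le i<j\le n),$$ $$s_{e_i+e_n}=s_is_{i+1}\cdots s_{n-2}s_ns_{n-2}\cdots s_{i+1}s_i\quad (1\le i<n),$$ $$s_{e_i+e_j}=(s_js_{j+1}\cdots s_{n-2}\cdot s_is_{i+1}\cdots s_{n-3})(s_{n-1}s_{n-2}s_ns_{n-2}s_{n-1})(s_{n-3}\cdots s_i\cdot s_{n-2}\cdots s_j)\quad(1\le i<j<n).$$ For the exceptional types, $[c_1c_2\cdots c_n]$ denotes the positive root $\alpha=\sum_k c_k\alpha_k$, and an entry "$[c_1\cdots c_n]: i_1i_2\cdots i_k$" means $s_\alpha=s_{i_1}s_{i_2}\cdots s_{i_k}$. **($G_2$)** The 6 reflections: $[10]: 1$; $[01]: 2$; $[11]: 212$; $[31]: 121$; $[21]: 12121$; $[32]: 21212$. **($F_4$)** The 24 reflections: $[1000]: 1$; $[0100]: 2$; $[1100]: 121$; $[1110]: 12321$; $[0110]: 232$; $[0010]: 3$; $[0120]: 323$; $[1120]: 13231$; $[1220]: 2132312$; $[0001]: 4$; $[0011]: 434$; $[0111]: 42324$; $[0121]: 3423243$; $[0122]: 43234$; $[1111]: 1423241$; $[1121]: 134232431$; $[1221]: 21342324312$; $[1231]: 3213423243123$;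 $[1122]: 1432341$; $[1222]: 214323412$; $[1242]: 32143234123$; $[1342]: 2321432341232$; $[1232]: 432134232431234$; $[2342]: 123214323412321$. **($E_6$)** The 36 reflections: $[100000]: 1$; $[101000]: 131$; $[101100]: 13431$; $[111100]: 1342431$; $[001000]: 3$; $[001100]: 343$; $[000100]: 4$; $[010000]: 2$; $[010100]: 424$; $[011100]: 34243$; $[000010]: 5$; $[000110]: 454$; $[001110]: 34543$; $[101110]: 1345431$; $[111110]: 132454231$; $[111210]: 41324542314$; $[112210]: 3413245423143$; $[010110]: 24542$; $[011110]: 3245423$; $[011210]: 432454234$; $[000001]: 6$; $[000011]: 656$; $[000111]: 65456$; $[001111]: 6543456$; $[010111]: 6542456$; $[011111]: 652434256$; $[011211]: 46524342564$; $[011221]: 5465243425645$; $[101111]: 134565431$; $[111111]: 16524342561$; $[111211]: 1465243425641$; $[111221]: 154652434256451$; $[112211]: 314652434256413$; $[112221]: 31546524342564513$; $[112321]: 4315465243425645134$; $[122321]: 243154652434256451342$. **($E_7$)** The 63 reflections are given by the 36 expressions of the $E_6$ list (for the roots with $c_7=0$, reading $[c_1\cdots c_6]$ as $[c_1\cdots c_60]$) together with the following 27: $[0000001]: 7$; $[0000011]: 767$; $[0000111]: 76567$; $[0001111]: 7654567$; $[0011111]: 765434567$; $[0101111]: 765424567$; $[0111111]: 76524342567$; $[0112111]: 4765243425674$; $[0112211]: 547652434256745$; $[0112221]: 65476524342567456$; $[1011111]: 13456765431$; $[1111111]: 7165243425617$; $[1112111]: 714652434256417$; $[1112211]: 71546524342564517$;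 $[1122111]: 73146524342564137$; $[1122211]: 7315465243425645137$; $[1123211]: 743154652434256451347$; $[1223211]: 72431546524342564513427$; $[1112221]: 6715465243425645176$; $[1122221]: 673154652434256451376$; $[1123221]: 67431546524342564513476$; $[1223221]: 6724315465243425645134276$; $[1123321]: 5674315465243425645134765$; $[1223321]: 256743154652434256451347652$; $[1224321]: 42567431546524342564513476524$; $[1234321]: 3425674315465243425645134765243$; $[2234321]: 134256743154652434256451347652431$. **($E_8$)** The 120 reflections are given by the 63 expressions of the $E_7$ list (for the roots with $c_8=0$, reading $[c_1\cdots c_7]$ as $[c_1\cdots c_70]$), together with the following 13: $[00000001]: 8$; $[00000011]: 878$; $[00000111]: 87678$; $[00001111]: 8765678$; $[00011111]: 876545678$; $[00111111]: 87654345678$; $[01011111]: 87654245678$; $[01111111]: 8765243425678$; $[01121111]: 487652434256784$; $[01122111]: 54876524342567845$; $[01122211]: 6548765243425678456$; $[01122221]: 765487652434256784567$; $[10111111]: 1345678765431$; and the following 44. In these, an entry "$[c_1\cdots c_8]: i_1\cdots i_k\,\ast$" means that $$s_\alpha = (s_{i_1}\cdots s_{i_k})\,(s_1s_6s_5s_2s_4s_3s_4s_2s_5s_6s_1)\,(s_{i_k}\cdots s_{i_1}),$$ the word on the right being the palindromic reduced expression: $[11111111]: 87\,\ast$; $[11121111]: 487\,\ast$; $[11221111]: 3487\,\ast$; $[11222111]: 53487\,\ast$; $[11232111]: 453487\,\ast$; $[12232111]: 2453487\,\ast$; $[12232211]: 62453487\,\ast$; $[11122111]: 5487\,\ast$;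 $[11122211]: 65487\,\ast$; $[11222211]: 365487\,\ast$; $[11232211]: 4365487\,\ast$; $[11233211]: 54365487\,\ast$; $[12233211]: 254365487\,\ast$; $[12243211]: 4254365487\,\ast$; $[12343211]: 34254365487\,\ast$; $[22343211]: 134254365487\,\ast$; $[11122221]: 765487\,\ast$; $[11222221]: 3765487\,\ast$; $[11232221]: 43765487\,\ast$; $[12232221]: 243765487\,\ast$; $[12233221]: 5243765487\,\ast$; $[12243221]: 45243765487\,\ast$; $[12343221]: 345243765487\,\ast$; $[22343221]: 1345243765487\,\ast$; $[11233221]: 543765487\,\ast$; $[11233321]: 6543765487\,\ast$; $[12233321]: 26543765487\,\ast$; $[12243321]: 426543765487\,\ast$; $[12343321]: 3426543765487\,\ast$; $[22343321]: 13426543765487\,\ast$; $[22344321]: 513426543765487\,\ast$; $[22354321]: 4513426543765487\,\ast$; $[22454321]: 34513426543765487\,\ast$; $[12244321]: 5426543765487\,\ast$; $[12344321]: 35426543765487\,\ast$; $[12354321]: 435426543765487\,\ast$; $[13354321]: 2435426543765487\,\ast$; $[23354321]: 12435426543765487\,\ast$; $[23454321]: 312435426543765487\,\ast$; $[23464321]: 4312435426543765487\,\ast$; $[23465321]: 54312435426543765487\,\ast$; $[23465421]: 654312435426543765487\,\ast$; $[23465431]: 7654312435426543765487\,\ast$; $[23465432]: 87654312435426543765487\,\ast$.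
   Context: **General conventions.** $W$ is the finite Weyl group of an irreducible crystallographic root system $\Phi$ of rank $n$ with simple roots $\Delta=(\alpha_1,\dots,\alpha_n)$. It acts on Euclidean space by $s_\alpha(\beta)=\beta-\frac{2(\alpha,\beta)}{(\alpha,\alpha)}\alpha$ for $\alpha\in\Phi$, where $(\cdot,\cdot)$ is the Euclidean dot product. $W$ is generated by the simple reflections $s_i=s_{\alpha_i}$, $S=\{s_1,\dots,s_n\}$. The positive roots $\Phi^+$ are those with non-negative coefficients in $\Delta$. The reflections of $W$ are the elements of $T=\{wsw^{-1}: w\in W,\ s\in S\}$. The map $\alpha\mapsto s_\alpha$ is a bijection $\Phi^+\to T$, with $s_\alpha=ws_iw^{-1}$ whenever $\alpha=w(\alpha_i)$. A word $s_{i_1}\cdots s_{i_k}$ is a reduced expression for $w$ if it equals $w$ and $k$ is minimal among all words in $S$ equal to $w$. It is palindromic if the sequence $(i_1,\dots,i_k)$ reads the same forwards and backwards. **Conventions for products.** A product $s_as_{a+1}\cdots s_b$ with $b<a$ is trivial (the empty word), and likewise for the reversed product $s_b\cdots s_{a+1}s_a$. Thus $s_a\cdots s_{b-1}s_bs_{b-1}\cdots s_a$ is just $s_b$ when $a=b$. - In types $B_n,C_n$, in the formula for $s_{e_i+e_j}$: $s_j\cdots s_{n-1}$ is trivial if $j=n$, and $s_i\cdots s_{n-2}$ is trivial if $i=n-1$. - In type $D_n$, in the formula for $s_{e_i+e_n}$: $s_i\cdots s_{n-2}$ is trivial if $i=n-1$. - In type $D_n$, in the formula for $s_{e_i+e_j}$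 with $j<n$: $s_j\cdots s_{n-2}$ is trivial if $j=n-1$, and $s_i\cdots s_{n-3}$ is trivial if $i=n-2$. **Choice of simple roots (Bourbaki labelling).** Below, $e_i$ is the $i$-th standard basis vector. - $A_n$ (in $\mathbb{R}^{n+1}$): $\alpha_i=e_i-e_{i+1}$ for $1\le i\le n$. - $B_n$ (in $\mathbb{R}^n$): $\alpha_i=e_i-e_{i+1}$ for $1\le i\le n-1$, $\alpha_n=e_n$. $\Phi^+=\{e_i\pm e_j: 1\le i<j\le n\}\cup\{e_i: 1\le i\le n\}$. - $C_n$ (in $\mathbb{R}^n$): $\alpha_i=e_i-e_{i+1}$ for $1\le i\le n-1$, $\alpha_n=2e_n$. $\Phi^+=\{e_i\pm e_j: 1\le i<j\le n\}\cup\{2e_i: 1\le i\le n\}$. - $D_n$ (in $\mathbb{R}^n$): $\alpha_i=e_i-e_{i+1}$ for $1\le i\le n-1$, $\alpha_n=e_{n-1}+e_n$. $\Phi^+=\{e_i\pm e_j: 1\le i<j\le n\}$. - $E_8$ (in $\mathbb{R}^8$): $\alpha_1=\frac12(e_1+e_8)-\frac12(e_2+e_3+e_4+e_5+e_6+e_7)$, $\alpha_2=e_1+e_2$, $\alpha_3=e_2-e_1$, $\alpha_4=e_3-e_2$, $\alpha_5=e_4-e_3$, $\alpha_6=e_5-e_4$, $\alpha_7=e_6-e_5$, $\alpha_8=e_7-e_6$. The Dynkin diagram has simple edges $1-3$, $3-4$, $4-5$, $5-6$, $6-7$, $7-8$ and $2-4$. - $E_7$ and $E_6$: the root subsystems with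 simple roots $\alpha_1,\dots,\alpha_7$ and $\alpha_1,\dots,\alpha_6$ respectively, from the $E_8$ list. - $F_4$ (in $\mathbb{R}^4$): $\alpha_1=e_2-e_3$, $\alpha_2=e_3-e_4$, $\alpha_3=e_4$, $\alpha_4=\frac12(e_1-e_2-e_3-e_4)$. - $G_2$ (in the plane $x_1+x_2+x_3=0$ of $\mathbb{R}^3$): $\alpha_1=e_1-e_2$ (short), $\alpha_2=-2e_1+e_2+e_3$ (long). *)

theory Defs
  imports
    "HOL-Algebra.Bij"
    "HOL-Algebra.Elementary_Groups"
    "Jordan_Normal_Form.Matrix"
begin

section \<open>Irreducible types and simple roots\<close>

datatype weyl_type =
    Type_A nat | Type_B nat | Type_C nat | Type_D nat
  | Type_E6 | Type_E7 | Type_E8 | Type_F4 | Type_G2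

fun valid_type :: "weyl_type \<Rightarrow> bool" where
  "valid_type (Type_A n) \<longleftrightarrow> n \<ge> 1"
| "valid_type (Type_B n) \<longleftrightarrow> n \<ge> 2"
| "valid_type (Type_C n) \<longleftrightarrow> n \<ge> 2"
| "valid_type (Type_D n) \<longleftrightarrow> n \<ge> 4"
| "valid_type _ \<longleftrightarrow> True"

fun weyl_rank :: "weyl_type \<Rightarrow> nat" where
  "weyl_rank (Type_A n) = n"
| "weyl_rank (Type_B n) = n"
| "weyl_rank (Type_C n) = n"
| "weyl_rank (Type_D n) = n"
| "weyl_rank Type_E6 = 6"
| "weyl_rank Type_E7 = 7"
| "weyl_rank Type_E8 = 8"
| "weyl_rank Type_F4 = 4"
| "weyl_rank Type_G2 = 2"

fun ambient_dim :: "weyl_type \<Rightarrow> nat" where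
  "ambient_dim (Type_A n) = n + 1"
| "ambient_dim (Type_B n) = n"
| "ambient_dim (Type_C n) = n"
| "ambient_dim (Type_D n) = n"
| "ambient_dim Type_E6 = 8"
| "ambient_dim Type_E7 = 8"
| "ambient_dim Type_E8 = 8"
| "ambient_dim Type_F4 = 4"
| "ambient_dim Type_G2 = 3"

abbreviation euclid :: "weyl_type \<Rightarrow> real vec set" where
  "euclid X \<equiv> carrier_vec (ambient_dim X)"

text \<open>Standard basis vectors are numbered from 1, whereas \<open>unit_vec\<close> counts from 0.\<close>

definition e :: "nat \<Rightarrow> nat \<Rightarrow> real vec" where
  "e N i = unit_vec N (i - 1)"

definition simple_root_E8 :: "nat \<Rightarrow> real vec" where
  "simple_root_E8 i =
     (if i = 1 then (1/2) \<cdot>\<^sub>v (e 8 1 + e 8 8)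
                    - (1/2) \<cdot>\<^sub>v (e 8 2 + e 8 3 + e 8 4 + e 8 5 + e 8 6 + e 8 7)
      else if i = 2 then e 8 1 + e 8 2
      else e 8 (i - 1) - e 8 (i - 2))"

text \<open>Only the values at \<open>i \<in> {1..weyl_rank X}\<close> are meaningful.\<close>

fun simple_root :: "weyl_type \<Rightarrow> nat \<Rightarrow> real vec" where
  "simple_root (Type_A n) i = e (n + 1) i - e (n + 1) (i + 1)"
| "simple_root (Type_B n) i = (if i < n then e n i - e n (i + 1) else e n n)"
| "simple_root (Type_C n) i = (if i < n then e n i - e n (i + 1) else 2 \<cdot>\<^sub>v e n n)"
| "simple_root (Type_D n) i = (if i < n then e n i - e n (i + 1) else e n (n - 1) + e n n)"
| "simple_root Type_E6 i = simple_root_E8 i"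
| "simple_root Type_E7 i = simple_root_E8 i"
| "simple_root Type_E8 i = simple_root_E8 i"
| "simple_root Type_F4 i =
     (if i = 1 then e 4 2 - e 4 3
      else if i = 2 then e 4 3 - e 4 4
      else if i = 3 then e 4 4
      else (1/2) \<cdot>\<^sub>v (e 4 1 - e 4 2 - e 4 3 - e 4 4))"
| "simple_root Type_G2 i =
     (if i = 1 then e 3 1 - e 3 2 else (-2) \<cdot>\<^sub>v e 3 1 + e 3 2 + e 3 3)"

definition root_comb :: "weyl_type \<Rightarrow> (nat \<Rightarrow> real) \<Rightarrow> real vec" where
  "root_comb X c =
     finsum_vec TYPE(real) (ambient_dim X) (\<lambda>k. c k \<cdot>\<^sub>v simple_root X k) {1..weyl_rank X}"


section \<open>Root systems\<close>

text \<open>Reflections are restricted to the ambient space, so that they are elements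
  of the library's group of bijections of that space.\<close>

definition root_reflection :: "weyl_type \<Rightarrow> real vec \<Rightarrow> real vec \<Rightarrow> real vec" where
  "root_reflection X \<alpha> =
     (\<lambda>\<beta> \<in> euclid X. \<beta> - (2 * (\<alpha> \<bullet> \<beta>) / (\<alpha> \<bullet> \<alpha>)) \<cdot>\<^sub>v \<alpha>)"

text \<open>Reduced crystallographic root systems. They need not span the ambient space:
  in types A, E6, E7 and G2 the roots span a proper subspace.\<close>

definition root_system :: "weyl_type \<Rightarrow> real vec set \<Rightarrow> bool" where
  "root_system X \<Phi> \<longleftrightarrow>
     finite \<Phi> \<and> \<Phi> \<subseteq> euclid X - {0\<^sub>v (ambient_dim X)} \<and>
     (\<forall>\<alpha>\<in>\<Phi>. \<forall>\<beta>\<in>\<Phi>. root_reflection X \<alpha> \<beta> \<in> \<Phi>) \<and>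
     (\<forall>\<alpha>\<in>\<Phi>. \<forall>\<beta>\<in>\<Phi>. 2 * (\<alpha> \<bullet> \<beta>) / (\<alpha> \<bullet> \<alpha>) \<in> \<int>) \<and>
     (\<forall>\<alpha>\<in>\<Phi>. \<forall>c. c \<cdot>\<^sub>v \<alpha> \<in> \<Phi> \<longrightarrow> c = 1 \<or> c = -1)"

definition irreducible_roots :: "real vec set \<Rightarrow> bool" where
  "irreducible_roots \<Phi> \<longleftrightarrow> \<Phi> \<noteq> {} \<and>
     (\<nexists>\<Phi>1 \<Phi>2. \<Phi>1 \<noteq> {} \<and> \<Phi>2 \<noteq> {} \<and> \<Phi> = \<Phi>1 \<union> \<Phi>2 \<and> \<Phi>1 \<inter> \<Phi>2 = {} \<and>
        (\<forall>\<alpha>\<in>\<Phi>1. \<forall>\<beta>\<in>\<Phi>2. \<alpha> \<bullet> \<beta> = 0))"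

definition has_simple_roots :: "weyl_type \<Rightarrow> real vec set \<Rightarrow> bool" where
  "has_simple_roots X \<Phi> \<longleftrightarrow>
     simple_root X ` {1..weyl_rank X} \<subseteq> \<Phi> \<and>
     (\<forall>c. root_comb X c = 0\<^sub>v (ambient_dim X) \<longrightarrow> (\<forall>k\<in>{1..weyl_rank X}. c k = 0)) \<and>
     (\<forall>\<alpha>\<in>\<Phi>. \<exists>c :: nat \<Rightarrow> int. \<alpha> = root_comb X (\<lambda>k. of_int (c k)) \<and>
        ((\<forall>k\<in>{1..weyl_rank X}. c k \<ge> 0) \<or> (\<forall>k\<in>{1..weyl_rank X}. c k \<le> 0)))"

definition positive_roots :: "weyl_type \<Rightarrow> real vec set \<Rightarrow> real vec set" where
  "positive_roots X \<Phi> =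
     {\<alpha> \<in> \<Phi>. \<exists>c. (\<forall>k\<in>{1..weyl_rank X}. c k \<ge> 0) \<and> \<alpha> = root_comb X c}"


section \<open>Weyl groups, reflections and words\<close>

definition simple_reflection :: "weyl_type \<Rightarrow> nat \<Rightarrow> real vec \<Rightarrow> real vec" where
  "simple_reflection X i = root_reflection X (simple_root X i)"

definition simple_reflections :: "weyl_type \<Rightarrow> (real vec \<Rightarrow> real vec) set" where
  "simple_reflections X = simple_reflection X ` {1..weyl_rank X}"

definition weyl_group :: "weyl_type \<Rightarrow> (real vec \<Rightarrow> real vec) monoid" where
  "weyl_group X = subgroup_generated (BijGroup (euclid X)) (simple_reflections X)"

definition reflections :: "weyl_type \<Rightarrow> (real vec \<Rightarrow> real vec) set" where
  "reflections X =
     {w \<otimes>\<^bsub>weyl_group X\<^esub> s \<otimes>\<^bsub>weyl_group X\<^esub> inv\<^bsub>weyl_group X\<^esub> w | w s.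
        w \<in> carrier (weyl_group X) \<and> s \<in> simple_reflections X}"

definition is_word :: "weyl_type \<Rightarrow> nat list \<Rightarrow> bool" where
  "is_word X u \<longleftrightarrow> set u \<subseteq> {1..weyl_rank X}"

definition word_prod :: "weyl_type \<Rightarrow> nat list \<Rightarrow> real vec \<Rightarrow> real vec" where
  "word_prod X u =
     foldr (\<lambda>i g. simple_reflection X i \<otimes>\<^bsub>weyl_group X\<^esub> g) u \<one>\<^bsub>weyl_group X\<^esub>"

definition reduced_expression :: "weyl_type \<Rightarrow> nat list \<Rightarrow> (real vec \<Rightarrow> real vec) \<Rightarrow> bool" where
  "reduced_expression X u g \<longleftrightarrow>
     is_word X u \<and> word_prod X u = g \<and>
     (\<forall>v. is_word X v \<and> word_prod X v = g \<longrightarrow> length u \<le> length v)"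

definition palindromic :: "nat list \<Rightarrow> bool" where
  "palindromic u \<longleftrightarrow> rev u = u"


section \<open>The lists of expressions: classical types\<close>

text \<open>\<open>asc a b\<close> is the word \<open>a, a+1, ..., b\<close> and \<open>desc b a\<close> its reversal; both are empty
  if \<open>b < a\<close>.\<close>

definition asc :: "nat \<Rightarrow> nat \<Rightarrow> nat list" where
  "asc a b = [a..<b + 1]"

definition desc :: "nat \<Rightarrow> nat \<Rightarrow> nat list" where
  "desc b a = rev (asc a b)"

definition list_A :: "nat \<Rightarrow> (real vec \<times> nat list) list" where
  "list_A n =
     [(e (n + 1) i - e (n + 1) (j + 1), asc i (j - 1) @ [j] @ desc (j - 1) i).
        i \<leftarrow> [1..<n + 1], j \<leftarrow> [i..<n + 1]]"

text \<open>The expressions for \<open>e\<^sub>i - e\<^sub>j\<close> coincide in types B, C and D, and those for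
  \<open>e\<^sub>i + e\<^sub>j\<close> coincide in types B and C.\<close>

definition list_minus :: "nat \<Rightarrow> (real vec \<times> nat list) list" where
  "list_minus n =
     [(e n i - e n j, asc i (j - 2) @ [j - 1] @ desc (j - 2) i).
        i \<leftarrow> [1..<n + 1], j \<leftarrow> [i + 1..<n + 1]]"

definition list_plus_BC :: "nat \<Rightarrow> (real vec \<times> nat list) list" where
  "list_plus_BC n =
     [(e n i + e n j,
       (asc j (n - 1) @ asc i (n - 2)) @ [n, n - 1, n] @ (desc (n - 2) i @ desc (n - 1) j)).
        i \<leftarrow> [1..<n + 1], j \<leftarrow> [i + 1..<n + 1]]"

definition list_B :: "nat \<Rightarrow> (real vec \<times> nat list) list" where
  "list_B n = list_minus n @ list_plus_BC n @
     [(e n i, asc i (n - 1) @ [n] @ desc (n - 1) i). i \<leftarrow> [1..<n + 1]]"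

definition list_C :: "nat \<Rightarrow> (real vec \<times> nat list) list" where
  "list_C n = list_minus n @ list_plus_BC n @
     [(2 \<cdot>\<^sub>v e n i, asc i (n - 1) @ [n] @ desc (n - 1) i). i \<leftarrow> [1..<n + 1]]"

definition list_D :: "nat \<Rightarrow> (real vec \<times> nat list) list" where
  "list_D n = list_minus n @
     [(e n i + e n n, asc i (n - 2) @ [n] @ desc (n - 2) i). i \<leftarrow> [1..<n]] @
     [(e n i + e n j,
       (asc j (n - 2) @ asc i (n - 3)) @ [n - 1, n - 2, n, n - 2, n - 1] @
       (desc (n - 3) i @ desc (n - 2) j)).
        i \<leftarrow> [1..<n], j \<leftarrow> [i + 1..<n]]"


section \<open>The lists of expressions: exceptional types\<close>

text \<open>A pair of a coefficient list \<open>[c\<^sub>1, ..., c\<^sub>n]\<close> with respect to the simple roots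
  and a word.\<close>

type_synonym coeff_entry = "nat list \<times> nat list"

definition list_G2 :: "coeff_entry list" where
  "list_G2 = [
     ([1,0], [1]),
     ([0,1], [2]),
     ([1,1], [2,1,2]),
     ([3,1], [1,2,1]),
     ([2,1], [1,2,1,2,1]),
     ([3,2], [2,1,2,1,2])]"

definition list_F4 :: "coeff_entry list" where
  "list_F4 = [
     ([1,0,0,0], [1]),
     ([0,1,0,0], [2]),
     ([1,1,0,0], [1,2,1]),
     ([1,1,1,0], [1,2,3,2,1]),
     ([0,1,1,0], [2,3,2]),
     ([0,0,1,0], [3]),
     ([0,1,2,0], [3,2,3]),
     ([1,1,2,0], [1,3,2,3,1]),
     ([1,2,2,0], [2,1,3,2,3,1,2]),
     ([0,0,0,1], [4]),
     ([0,0,1,1], [4,3,4]),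
     ([0,1,1,1], [4,2,3,2,4]),
     ([0,1,2,1], [3,4,2,3,2,4,3]),
     ([0,1,2,2], [4,3,2,3,4]),
     ([1,1,1,1], [1,4,2,3,2,4,1]),
     ([1,1,2,1], [1,3,4,2,3,2,4,3,1]),
     ([1,2,2,1], [2,1,3,4,2,3,2,4,3,1,2]),
     ([1,2,3,1], [3,2,1,3,4,2,3,2,4,3,1,2,3]),
     ([1,1,2,2], [1,4,3,2,3,4,1]),
     ([1,2,2,2], [2,1,4,3,2,3,4,1,2]),
     ([1,2,4,2], [3,2,1,4,3,2,3,4,1,2,3]),
     ([1,3,4,2], [2,3,2,1,4,3,2,3,4,1,2,3,2]),
     ([1,2,3,2], [4,3,2,1,3,4,2,3,2,4,3,1,2,3,4]),
     ([2,3,4,2], [1,2,3,2,1,4,3,2,3,4,1,2,3,2,1])]"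

definition list_E6 :: "coeff_entry list" where
  "list_E6 = [
     ([1,0,0,0,0,0], [1]),
     ([1,0,1,0,0,0], [1,3,1]),
     ([1,0,1,1,0,0], [1,3,4,3,1]),
     ([1,1,1,1,0,0], [1,3,4,2,4,3,1]),
     ([0,0,1,0,0,0], [3]),
     ([0,0,1,1,0,0], [3,4,3]),
     ([0,0,0,1,0,0], [4]),
     ([0,1,0,0,0,0], [2]),
     ([0,1,0,1,0,0], [4,2,4]),
     ([0,1,1,1,0,0], [3,4,2,4,3]),
     ([0,0,0,0,1,0], [5]),
     ([0,0,0,1,1,0], [4,5,4]),
     ([0,0,1,1,1,0], [3,4,5,4,3]),
     ([1,0,1,1,1,0], [1,3,4,5,4,3,1]),
     ([1,1,1,1,1,0], [1,3,2,4,5,4,2,3,1]),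
     ([1,1,1,2,1,0], [4,1,3,2,4,5,4,2,3,1,4]),
     ([1,1,2,2,1,0], [3,4,1,3,2,4,5,4,2,3,1,4,3]),
     ([0,1,0,1,1,0], [2,4,5,4,2]),
     ([0,1,1,1,1,0], [3,2,4,5,4,2,3]),
     ([0,1,1,2,1,0], [4,3,2,4,5,4,2,3,4]),
     ([0,0,0,0,0,1], [6]),
     ([0,0,0,0,1,1], [6,5,6]),
     ([0,0,0,1,1,1], [6,5,4,5,6]),
     ([0,0,1,1,1,1], [6,5,4,3,4,5,6]),
     ([0,1,0,1,1,1], [6,5,4,2,4,5,6]),
     ([0,1,1,1,1,1], [6,5,2,4,3,4,2,5,6]),
     ([0,1,1,2,1,1], [4,6,5,2,4,3,4,2,5,6,4]),
     ([0,1,1,2,2,1], [5,4,6,5,2,4,3,4,2,5,6,4,5]),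
     ([1,0,1,1,1,1], [1,3,4,5,6,5,4,3,1]),
     ([1,1,1,1,1,1], [1,6,5,2,4,3,4,2,5,6,1]),
     ([1,1,1,2,1,1], [1,4,6,5,2,4,3,4,2,5,6,4,1]),
     ([1,1,1,2,2,1], [1,5,4,6,5,2,4,3,4,2,5,6,4,5,1]),
     ([1,1,2,2,1,1], [3,1,4,6,5,2,4,3,4,2,5,6,4,1,3]),
     ([1,1,2,2,2,1], [3,1,5,4,6,5,2,4,3,4,2,5,6,4,5,1,3]),
     ([1,1,2,3,2,1], [4,3,1,5,4,6,5,2,4,3,4,2,5,6,4,5,1,3,4]),
     ([1,2,2,3,2,1], [2,4,3,1,5,4,6,5,2,4,3,4,2,5,6,4,5,1,3,4,2])]"

text \<open>A root of a smaller root system of type E is a root of the next larger one, with new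
  coefficient 0.\<close>

definition append_zero :: "coeff_entry \<Rightarrow> coeff_entry" where
  "append_zero = (\<lambda>(c, u). (c @ [0], u))"

definition list_E7 :: "coeff_entry list" where
  "list_E7 = map append_zero list_E6 @ [
     ([0,0,0,0,0,0,1], [7]),
     ([0,0,0,0,0,1,1], [7,6,7]),
     ([0,0,0,0,1,1,1], [7,6,5,6,7]),
     ([0,0,0,1,1,1,1], [7,6,5,4,5,6,7]),
     ([0,0,1,1,1,1,1], [7,6,5,4,3,4,5,6,7]),
     ([0,1,0,1,1,1,1], [7,6,5,4,2,4,5,6,7]),
     ([0,1,1,1,1,1,1], [7,6,5,2,4,3,4,2,5,6,7]),
     ([0,1,1,2,1,1,1], [4,7,6,5,2,4,3,4,2,5,6,7,4]),
     ([0,1,1,2,2,1,1], [5,4,7,6,5,2,4,3,4,2,5,6,7,4,5]),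
     ([0,1,1,2,2,2,1], [6,5,4,7,6,5,2,4,3,4,2,5,6,7,4,5,6]),
     ([1,0,1,1,1,1,1], [1,3,4,5,6,7,6,5,4,3,1]),
     ([1,1,1,1,1,1,1], [7,1,6,5,2,4,3,4,2,5,6,1,7]),
     ([1,1,1,2,1,1,1], [7,1,4,6,5,2,4,3,4,2,5,6,4,1,7]),
     ([1,1,1,2,2,1,1], [7,1,5,4,6,5,2,4,3,4,2,5,6,4,5,1,7]),
     ([1,1,2,2,1,1,1], [7,3,1,4,6,5,2,4,3,4,2,5,6,4,1,3,7]),
     ([1,1,2,2,2,1,1], [7,3,1,5,4,6,5,2,4,3,4,2,5,6,4,5,1,3,7]),
     ([1,1,2,3,2,1,1], [7,4,3,1,5,4,6,5,2,4,3,4,2,5,6,4,5,1,3,4,7]),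
     ([1,2,2,3,2,1,1], [7,2,4,3,1,5,4,6,5,2,4,3,4,2,5,6,4,5,1,3,4,2,7]),
     ([1,1,1,2,2,2,1], [6,7,1,5,4,6,5,2,4,3,4,2,5,6,4,5,1,7,6]),
     ([1,1,2,2,2,2,1], [6,7,3,1,5,4,6,5,2,4,3,4,2,5,6,4,5,1,3,7,6]),
     ([1,1,2,3,2,2,1], [6,7,4,3,1,5,4,6,5,2,4,3,4,2,5,6,4,5,1,3,4,7,6]),
     ([1,2,2,3,2,2,1], [6,7,2,4,3,1,5,4,6,5,2,4,3,4,2,5,6,4,5,1,3,4,2,7,6]),
     ([1,1,2,3,3,2,1], [5,6,7,4,3,1,5,4,6,5,2,4,3,4,2,5,6,4,5,1,3,4,7,6,5]),
     ([1,2,2,3,3,2,1], [2,5,6,7,4,3,1,5,4,6,5,2,4,3,4,2,5,6,4,5,1,3,4,7,6,5,2]),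
     ([1,2,2,4,3,2,1], [4,2,5,6,7,4,3,1,5,4,6,5,2,4,3,4,2,5,6,4,5,1,3,4,7,6,5,2,4]),
     ([1,2,3,4,3,2,1], [3,4,2,5,6,7,4,3,1,5,4,6,5,2,4,3,4,2,5,6,4,5,1,3,4,7,6,5,2,4,3]),
     ([2,2,3,4,3,2,1], [1,3,4,2,5,6,7,4,3,1,5,4,6,5,2,4,3,4,2,5,6,4,5,1,3,4,7,6,5,2,4,3,1])]"

definition star :: "nat list \<Rightarrow> nat list" where
  "star u = u @ [1,6,5,2,4,3,4,2,5,6,1] @ rev u"

definition list_E8 :: "coeff_entry list" where
  "list_E8 = map append_zero list_E7 @ [
     ([0,0,0,0,0,0,0,1], [8]),
     ([0,0,0,0,0,0,1,1], [8,7,8]),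
     ([0,0,0,0,0,1,1,1], [8,7,6,7,8]),
     ([0,0,0,0,1,1,1,1], [8,7,6,5,6,7,8]),
     ([0,0,0,1,1,1,1,1], [8,7,6,5,4,5,6,7,8]),
     ([0,0,1,1,1,1,1,1], [8,7,6,5,4,3,4,5,6,7,8]),
     ([0,1,0,1,1,1,1,1], [8,7,6,5,4,2,4,5,6,7,8]),
     ([0,1,1,1,1,1,1,1], [8,7,6,5,2,4,3,4,2,5,6,7,8]),
     ([0,1,1,2,1,1,1,1], [4,8,7,6,5,2,4,3,4,2,5,6,7,8,4]),
     ([0,1,1,2,2,1,1,1], [5,4,8,7,6,5,2,4,3,4,2,5,6,7,8,4,5]),
     ([0,1,1,2,2,2,1,1], [6,5,4,8,7,6,5,2,4,3,4,2,5,6,7,8,4,5,6]),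
     ([0,1,1,2,2,2,2,1], [7,6,5,4,8,7,6,5,2,4,3,4,2,5,6,7,8,4,5,6,7]),
     ([1,0,1,1,1,1,1,1], [1,3,4,5,6,7,8,7,6,5,4,3,1])] @
   map (\<lambda>(c, u). (c, star u)) [
     ([1,1,1,1,1,1,1,1], [8,7]),
     ([1,1,1,2,1,1,1,1], [4,8,7]),
     ([1,1,2,2,1,1,1,1], [3,4,8,7]),
     ([1,1,2,2,2,1,1,1], [5,3,4,8,7]),
     ([1,1,2,3,2,1,1,1], [4,5,3,4,8,7]),
     ([1,2,2,3,2,1,1,1], [2,4,5,3,4,8,7]),
     ([1,2,2,3,2,2,1,1], [6,2,4,5,3,4,8,7]),
     ([1,1,1,2,2,1,1,1], [5,4,8,7]),
     ([1,1,1,2,2,2,1,1], [6,5,4,8,7]),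
     ([1,1,2,2,2,2,1,1], [3,6,5,4,8,7]),
     ([1,1,2,3,2,2,1,1], [4,3,6,5,4,8,7]),
     ([1,1,2,3,3,2,1,1], [5,4,3,6,5,4,8,7]),
     ([1,2,2,3,3,2,1,1], [2,5,4,3,6,5,4,8,7]),
     ([1,2,2,4,3,2,1,1], [4,2,5,4,3,6,5,4,8,7]),
     ([1,2,3,4,3,2,1,1], [3,4,2,5,4,3,6,5,4,8,7]),
     ([2,2,3,4,3,2,1,1], [1,3,4,2,5,4,3,6,5,4,8,7]),
     ([1,1,1,2,2,2,2,1], [7,6,5,4,8,7]),
     ([1,1,2,2,2,2,2,1], [3,7,6,5,4,8,7]),
     ([1,1,2,3,2,2,2,1], [4,3,7,6,5,4,8,7]),
     ([1,2,2,3,2,2,2,1], [2,4,3,7,6,5,4,8,7]),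
     ([1,2,2,3,3,2,2,1], [5,2,4,3,7,6,5,4,8,7]),
     ([1,2,2,4,3,2,2,1], [4,5,2,4,3,7,6,5,4,8,7]),
     ([1,2,3,4,3,2,2,1], [3,4,5,2,4,3,7,6,5,4,8,7]),
     ([2,2,3,4,3,2,2,1], [1,3,4,5,2,4,3,7,6,5,4,8,7]),
     ([1,1,2,3,3,2,2,1], [5,4,3,7,6,5,4,8,7]),
     ([1,1,2,3,3,3,2,1], [6,5,4,3,7,6,5,4,8,7]),
     ([1,2,2,3,3,3,2,1], [2,6,5,4,3,7,6,5,4,8,7]),
     ([1,2,2,4,3,3,2,1], [4,2,6,5,4,3,7,6,5,4,8,7]),
     ([1,2,3,4,3,3,2,1], [3,4,2,6,5,4,3,7,6,5,4,8,7]),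
     ([2,2,3,4,3,3,2,1], [1,3,4,2,6,5,4,3,7,6,5,4,8,7]),
     ([2,2,3,4,4,3,2,1], [5,1,3,4,2,6,5,4,3,7,6,5,4,8,7]),
     ([2,2,3,5,4,3,2,1], [4,5,1,3,4,2,6,5,4,3,7,6,5,4,8,7]),
     ([2,2,4,5,4,3,2,1], [3,4,5,1,3,4,2,6,5,4,3,7,6,5,4,8,7]),
     ([1,2,2,4,4,3,2,1], [5,4,2,6,5,4,3,7,6,5,4,8,7]),
     ([1,2,3,4,4,3,2,1], [3,5,4,2,6,5,4,3,7,6,5,4,8,7]),
     ([1,2,3,5,4,3,2,1], [4,3,5,4,2,6,5,4,3,7,6,5,4,8,7]),
     ([1,3,3,5,4,3,2,1], [2,4,3,5,4,2,6,5,4,3,7,6,5,4,8,7]),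
     ([2,3,3,5,4,3,2,1], [1,2,4,3,5,4,2,6,5,4,3,7,6,5,4,8,7]),
     ([2,3,4,5,4,3,2,1], [3,1,2,4,3,5,4,2,6,5,4,3,7,6,5,4,8,7]),
     ([2,3,4,6,4,3,2,1], [4,3,1,2,4,3,5,4,2,6,5,4,3,7,6,5,4,8,7]),
     ([2,3,4,6,5,3,2,1], [5,4,3,1,2,4,3,5,4,2,6,5,4,3,7,6,5,4,8,7]),
     ([2,3,4,6,5,4,2,1], [6,5,4,3,1,2,4,3,5,4,2,6,5,4,3,7,6,5,4,8,7]),
     ([2,3,4,6,5,4,3,1], [7,6,5,4,3,1,2,4,3,5,4,2,6,5,4,3,7,6,5,4,8,7]),
     ([2,3,4,6,5,4,3,2], [8,7,6,5,4,3,1,2,4,3,5,4,2,6,5,4,3,7,6,5,4,8,7])]"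

definition entries_of_coeffs :: "weyl_type \<Rightarrow> coeff_entry list \<Rightarrow> (real vec \<times> nat list) list" where
  "entries_of_coeffs X = map (\<lambda>(c, u). (root_comb X (\<lambda>k. of_nat (c ! (k - 1))), u))"

fun reflection_list :: "weyl_type \<Rightarrow> (real vec \<times> nat list) list" where
  "reflection_list (Type_A n) = list_A n"
| "reflection_list (Type_B n) = list_B n"
| "reflection_list (Type_C n) = list_C n"
| "reflection_list (Type_D n) = list_D n"
| "reflection_list Type_E6 = entries_of_coeffs Type_E6 list_E6"
| "reflection_list Type_E7 = entries_of_coeffs Type_E7 list_E7"
| "reflection_list Type_E8 = entries_of_coeffs Type_E8 list_E8"
| "reflection_list Type_F4 = entries_of_coeffs Type_F4 list_F4"
| "reflection_list Type_G2 = entries_of_coeffs Type_G2 list_G2"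

end

theory Submission
  imports Defs
begin

text \<open>
  The words of all nine lists have one common shape: a palindrome that starts with a single
  letter \<open>k\<close> and is enlarged by wrapping letters \<open>i\<close> around it, where each wrapping moves the
  current root \<open>\<beta>\<close> up to \<open>s\<^sub>i(\<beta>)\<close> because \<open>(\<alpha>\<^sub>i, \<beta>) < 0\<close>. Such ascending palindromes explain every
  claim about a single entry. Since \<open>s\<^sub>i s\<^sub>\<beta> s\<^sub>i\<close> is the reflection in \<open>s\<^sub>i(\<beta>)\<close>, the word
  multiplies to the reflection in the last root. It is reduced because each wrapping adds two
  letters and also adds two inversions (positive roots made negative), while a word of length
  \<open>l\<close> never produces more than \<open>l\<close> inversions. This is
  \<open>length_le_card_inversions\<close> against \<open>card_inversions_le_length\<close>.

  Completeness of a list follows from descent: a positive root that is not simple is lowered by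
  some simple reflection, so a set of roots that contains the simple roots and is closed under
  upward simple reflections contains all positive roots (\<open>positive_roots_minimal\<close>). Distinct
  positive roots have distinct reflections because the root system is reduced, and every
  conjugate of a simple reflection is the reflection in a root. Thus \<open>reflection_list_criterion\<close>
  reduces each type to three facts: the words ascend, the roots are pairwise distinct, and they
  are closed under upward reflections.

  In the classical types these facts are read off from the action on the standard basis, which
  simple reflections permute up to signs. In the exceptional types they are computed with
  integer coefficient lists and the Cartan matrix (\<open>complete_coeff_list_criterion\<close>).
\<close>

section \<open>Reflections as isometries\<close>

lemma root_reflection_apply:
  "\<beta> \<in> euclid X \<Longrightarrow>
   root_reflection X \<alpha> \<beta> = \<beta> - (2 * (\<alpha> \<bullet> \<beta>) / (\<alpha> \<bullet> \<alpha>)) \<cdot>\<^sub>v \<alpha>"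
  by (simp add: root_reflection_def)

lemma root_reflection_closed [simp, intro]:
  "\<alpha> \<in> euclid X \<Longrightarrow> \<beta> \<in> euclid X \<Longrightarrow> root_reflection X \<alpha> \<beta> \<in> euclid X"
  by (simp add: root_reflection_apply)

lemma scalar_prod_self_pos:
  fixes v :: "real vec"
  assumes "v \<in> carrier_vec n" "v \<noteq> 0\<^sub>v n"
  shows "v \<bullet> v > 0"
proof -
  have "\<exists>i<n. v $ i \<noteq> 0"
    using assms by (metis carrier_vecD eq_vecI index_zero_vec(1) index_zero_vec(2))
  then obtain i where "i < n" "v $ i \<noteq> 0" by blast
  then have "(\<Sum>i\<in>{0..<n}. v $ i * v $ i) > 0"
    by (intro sum_pos2[of _ i]) (auto simp: zero_less_mult_iff)
  then show ?thesis using assms by (simp add: scalar_prod_def)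
qed

lemma root_reflection_index:
  assumes "\<alpha> \<in> euclid X" "\<beta> \<in> euclid X" "i < ambient_dim X"
  shows "root_reflection X \<alpha> \<beta> $ i = \<beta> $ i - 2 * (\<alpha> \<bullet> \<beta>) / (\<alpha> \<bullet> \<alpha>) * \<alpha> $ i"
  using assms by (simp add: root_reflection_apply)

lemma scalar_prod_root_reflection:
  assumes "\<alpha> \<in> euclid X" "\<beta> \<in> euclid X" "\<gamma> \<in> euclid X"
  shows "\<gamma> \<bullet> root_reflection X \<alpha> \<beta> = \<gamma> \<bullet> \<beta> - 2 * (\<alpha> \<bullet> \<beta>) / (\<alpha> \<bullet> \<alpha>) * (\<gamma> \<bullet> \<alpha>)"
  using assms
  by (simp add: root_reflection_apply scalar_prod_minus_distrib[of _ "ambient_dim X"])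

lemma root_reflection_isometry:
  assumes "\<alpha> \<in> euclid X" "\<alpha> \<noteq> 0\<^sub>v (ambient_dim X)" "\<beta> \<in> euclid X" "\<gamma> \<in> euclid X"
  shows "root_reflection X \<alpha> \<beta> \<bullet> root_reflection X \<alpha> \<gamma> = \<beta> \<bullet> \<gamma>"
proof -
  have pos: "\<alpha> \<bullet> \<alpha> > 0" using assms scalar_prod_self_pos by blast
  have c: "\<And>u v. u \<in> euclid X \<Longrightarrow> v \<in> euclid X \<Longrightarrow> u \<bullet> v = v \<bullet> u"
    by (rule comm_scalar_prod)
  have "root_reflection X \<alpha> \<beta> \<bullet> \<alpha> = - (\<alpha> \<bullet> \<beta>)"
    using assms pos c[of "root_reflection X \<alpha> \<beta>" \<alpha>]
    by (simp add: scalar_prod_root_reflection)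
  moreover have "root_reflection X \<alpha> \<beta> \<bullet> \<gamma> = \<beta> \<bullet> \<gamma> - 2 * (\<alpha> \<bullet> \<beta>) / (\<alpha> \<bullet> \<alpha>) * (\<alpha> \<bullet> \<gamma>)"
    using assms c[of "root_reflection X \<alpha> \<beta>" \<gamma>] c[of \<beta> \<gamma>] c[of \<alpha> \<gamma>]
    by (simp add: scalar_prod_root_reflection)
  ultimately show ?thesis
    using assms pos by (simp add: scalar_prod_root_reflection)
qed

lemma root_reflection_self:
  assumes "\<alpha> \<in> euclid X" "\<alpha> \<noteq> 0\<^sub>v (ambient_dim X)"
  shows "root_reflection X \<alpha> \<alpha> = - \<alpha>"
proof (rule eq_vecI)
  have pos: "\<alpha> \<bullet> \<alpha> > 0" using assms scalar_prod_self_pos by blast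
  fix i assume "i < dim_vec (- \<alpha>)"
  then show "root_reflection X \<alpha> \<alpha> $ i = (- \<alpha>) $ i"
    using assms pos by (simp add: root_reflection_index)
qed (use assms in \<open>simp add: root_reflection_apply\<close>)

lemma root_reflection_smult:
  assumes "\<alpha> \<in> euclid X" "\<beta> \<in> euclid X"
  shows "root_reflection X \<alpha> (c \<cdot>\<^sub>v \<beta>) = c \<cdot>\<^sub>v root_reflection X \<alpha> \<beta>"
  by (rule eq_vecI) (use assms in \<open>auto simp: root_reflection_apply algebra_simps\<close>)

lemma root_reflection_add:
  assumes "\<alpha> \<in> euclid X" "\<beta> \<in> euclid X" "\<gamma> \<in> euclid X"
  shows "root_reflection X \<alpha> (\<beta> + \<gamma>) = root_reflection X \<alpha> \<beta> + root_reflection X \<alpha> \<gamma>"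
  by (rule eq_vecI)
     (use assms in \<open>auto simp: root_reflection_apply scalar_prod_add_distrib[of _ "ambient_dim X"]
        algebra_simps add_divide_distrib\<close>)

lemma root_reflection_minus:
  assumes "\<alpha> \<in> euclid X" "\<beta> \<in> euclid X" "\<gamma> \<in> euclid X"
  shows "root_reflection X \<alpha> (\<beta> - \<gamma>) = root_reflection X \<alpha> \<beta> - root_reflection X \<alpha> \<gamma>"
  by (rule eq_vecI)
     (use assms in \<open>auto simp: root_reflection_apply scalar_prod_minus_distrib[of _ "ambient_dim X"]
        algebra_simps diff_divide_distrib\<close>)

lemma root_reflection_uminus:
  assumes "\<alpha> \<in> euclid X" "\<beta> \<in> euclid X"
  shows "root_reflection X \<alpha> (- \<beta>) = - root_reflection X \<alpha> \<beta>"
  by (rule eq_vecI) (use assms in \<open>auto simp: root_reflection_apply\<close>)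

lemma root_reflection_of_uminus:
  assumes "\<alpha> \<in> euclid X"
  shows "root_reflection X (- \<alpha>) = root_reflection X \<alpha>"
proof
  fix \<beta>
  show "root_reflection X (- \<alpha>) \<beta> = root_reflection X \<alpha> \<beta>"
  proof (cases "\<beta> \<in> euclid X")
    case True
    show ?thesis
      by (rule eq_vecI) (use assms True in \<open>auto simp: root_reflection_apply\<close>)
  qed (simp add: root_reflection_def)
qed

lemma root_reflection_involution:
  assumes "\<alpha> \<in> euclid X" "\<alpha> \<noteq> 0\<^sub>v (ambient_dim X)" "\<beta> \<in> euclid X"
  shows "root_reflection X \<alpha> (root_reflection X \<alpha> \<beta>) = \<beta>"
proof (rule eq_vecI)
  have pos: "\<alpha> \<bullet> \<alpha> > 0" using assms scalar_prod_self_pos by blast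
  fix i assume "i < dim_vec \<beta>"
  then show "root_reflection X \<alpha> (root_reflection X \<alpha> \<beta>) $ i = \<beta> $ i"
    using assms pos by (simp add: root_reflection_index scalar_prod_root_reflection)
qed (use assms in \<open>auto simp: root_reflection_apply\<close>)

lemma root_reflection_Bij:
  assumes "\<alpha> \<in> euclid X" "\<alpha> \<noteq> 0\<^sub>v (ambient_dim X)"
  shows "root_reflection X \<alpha> \<in> Bij (euclid X)"
proof -
  have "bij_betw (root_reflection X \<alpha>) (euclid X) (euclid X)"
    by (rule bij_betw_byWitness[where f' = "root_reflection X \<alpha>"])
       (use assms root_reflection_involution in auto)
  then show ?thesis by (simp add: Bij_def root_reflection_def)
qed

text \<open>\<open>s\<^sub>\<delta> s\<^sub>\<alpha> s\<^sub>\<delta>\<close> is the reflection in \<open>s\<^sub>\<delta>(\<alpha>)\<close>, because \<open>s\<^sub>\<delta>\<close> is a linear isometry.\<close>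

lemma root_reflection_conj:
  assumes "\<delta> \<in> euclid X" "\<delta> \<noteq> 0\<^sub>v (ambient_dim X)" "\<alpha> \<in> euclid X" "\<beta> \<in> euclid X"
  shows "root_reflection X \<delta> (root_reflection X \<alpha> (root_reflection X \<delta> \<beta>)) =
         root_reflection X (root_reflection X \<delta> \<alpha>) \<beta>"
proof -
  let ?d = "root_reflection X \<delta>"
  have "?d (root_reflection X \<alpha> (?d \<beta>)) =
      ?d (?d \<beta>) - (2 * (\<alpha> \<bullet> ?d \<beta>) / (\<alpha> \<bullet> \<alpha>)) \<cdot>\<^sub>v ?d \<alpha>"
    using assms by (simp add: root_reflection_apply[of "?d \<beta>" _ \<alpha>] root_reflection_minus
        root_reflection_smult)
  moreover have "\<alpha> \<bullet> ?d \<beta> = ?d \<alpha> \<bullet> \<beta>"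
    using root_reflection_isometry[of \<delta> X \<alpha> "?d \<beta>"] assms
    by (simp add: root_reflection_involution)
  moreover have "\<alpha> \<bullet> \<alpha> = ?d \<alpha> \<bullet> ?d \<alpha>"
    using assms by (simp add: root_reflection_isometry)
  ultimately show ?thesis
    using assms by (simp add: root_reflection_involution root_reflection_apply[of \<beta> _ "?d \<alpha>"])
qed


section \<open>Linear combinations of the simple roots\<close>

lemma root_comb_closed:
  assumes "simple_root X ` {1..weyl_rank X} \<subseteq> euclid X"
  shows "root_comb X c \<in> euclid X"
  unfolding root_comb_def by (rule finsum_vec_closed) (use assms in auto)

lemma root_comb_index:
  assumes "simple_root X ` {1..weyl_rank X} \<subseteq> euclid X" "i < ambient_dim X"
  shows "root_comb X c $ i = (\<Sum>k\<in>{1..weyl_rank X}. c k * simple_root X k $ i)"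
proof -
  have "root_comb X c $ i = (\<Sum>k\<in>{1..weyl_rank X}. (c k \<cdot>\<^sub>v simple_root X k) $ i)"
    unfolding root_comb_def by (rule index_finsum_vec) (use assms in auto)
  also have "\<dots> = (\<Sum>k\<in>{1..weyl_rank X}. c k * simple_root X k $ i)"
  proof (rule sum.cong)
    fix k assume "k \<in> {1..weyl_rank X}"
    then have "simple_root X k \<in> euclid X" using assms(1) by blast
    then show "(c k \<cdot>\<^sub>v simple_root X k) $ i = c k * simple_root X k $ i"
      using assms(2) by simp
  qed simp
  finally show ?thesis .
qed

lemma scalar_prod_root_comb:
  assumes S: "simple_root X ` {1..weyl_rank X} \<subseteq> euclid X" and v: "v \<in> euclid X"
  shows "v \<bullet> root_comb X c = (\<Sum>k\<in>{1..weyl_rank X}. c k * (v \<bullet> simple_root X k))"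
proof -
  have d: "dim_vec (root_comb X c) = ambient_dim X"
    using root_comb_closed[OF S] by (rule carrier_vecD)
  have "v \<bullet> root_comb X c =
      (\<Sum>i<ambient_dim X. \<Sum>k\<in>{1..weyl_rank X}. c k * (v $ i * simple_root X k $ i))"
    by (auto simp: scalar_prod_def d root_comb_index[OF S] sum_distrib_left atLeast0LessThan
        algebra_simps intro!: sum.cong)
  also have "\<dots> = (\<Sum>k\<in>{1..weyl_rank X}. \<Sum>i<ambient_dim X. c k * (v $ i * simple_root X k $ i))"
    by (rule sum.swap)
  also have "\<dots> = (\<Sum>k\<in>{1..weyl_rank X}. c k * (v \<bullet> simple_root X k))"
  proof (rule sum.cong)
    fix k assume "k \<in> {1..weyl_rank X}"
    then have "simple_root X k \<in> euclid X" using S by blast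
    then have "dim_vec (simple_root X k) = ambient_dim X" by (rule carrier_vecD)
    then show "(\<Sum>i<ambient_dim X. c k * (v $ i * simple_root X k $ i)) =
        c k * (v \<bullet> simple_root X k)"
      by (simp add: scalar_prod_def sum_distrib_left atLeast0LessThan)
  qed simp
  finally show ?thesis .
qed

lemma root_comb_single:
  assumes S: "simple_root X ` {1..weyl_rank X} \<subseteq> euclid X" and i: "i \<in> {1..weyl_rank X}"
  shows "root_comb X (\<lambda>k. if k = i then 1 else 0) = simple_root X i"
proof (rule eq_vecI)
  have Si: "simple_root X i \<in> euclid X" using assms by blast
  then show "dim_vec (root_comb X (\<lambda>k. if k = i then 1 else 0)) = dim_vec (simple_root X i)"
    using root_comb_closed[OF S] carrier_vecD by metis
  fix j assume "j < dim_vec (simple_root X i)"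
  then have "j < ambient_dim X" using Si by simp
  then show "root_comb X (\<lambda>k. if k = i then 1 else 0) $ j = simple_root X i $ j"
    using i by (simp add: root_comb_index[OF S] if_distrib[of "\<lambda>x. x * _"] sum.delta cong: if_cong)
qed

lemma root_comb_diff_smult:
  assumes S: "simple_root X ` {1..weyl_rank X} \<subseteq> euclid X"
  shows "root_comb X c - a \<cdot>\<^sub>v root_comb X d = root_comb X (\<lambda>k. c k - a * d k)"
proof (rule eq_vecI)
  have d: "\<And>c. dim_vec (root_comb X c) = ambient_dim X"
    using root_comb_closed[OF S] carrier_vecD by blast
  then show "dim_vec (root_comb X c - a \<cdot>\<^sub>v root_comb X d) =
      dim_vec (root_comb X (\<lambda>k. c k - a * d k))" by simp
  fix i assume "i < dim_vec (root_comb X (\<lambda>k. c k - a * d k))"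
  then have "i < ambient_dim X" by (simp add: d)
  then show "(root_comb X c - a \<cdot>\<^sub>v root_comb X d) $ i = root_comb X (\<lambda>k. c k - a * d k) $ i"
    by (simp add: d root_comb_index[OF S] sum_distrib_left sum_subtractf algebra_simps)
qed

lemma root_comb_smult:
  assumes S: "simple_root X ` {1..weyl_rank X} \<subseteq> euclid X"
  shows "a \<cdot>\<^sub>v root_comb X c = root_comb X (\<lambda>k. a * c k)"
proof (rule eq_vecI)
  have d: "\<And>c. dim_vec (root_comb X c) = ambient_dim X"
    using root_comb_closed[OF S] carrier_vecD by blast
  then show "dim_vec (a \<cdot>\<^sub>v root_comb X c) = dim_vec (root_comb X (\<lambda>k. a * c k))" by simp
  fix i assume "i < dim_vec (root_comb X (\<lambda>k. a * c k))"
  then show "(a \<cdot>\<^sub>v root_comb X c) $ i = root_comb X (\<lambda>k. a * c k) $ i"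
    by (simp add: d root_comb_index[OF S] sum_distrib_left algebra_simps)
qed

lemma root_comb_cong:
  "(\<And>k. k \<in> {1..weyl_rank X} \<Longrightarrow> c k = d k) \<Longrightarrow>
   simple_root X ` {1..weyl_rank X} \<subseteq> euclid X \<Longrightarrow> root_comb X c = root_comb X d"
  using root_comb_closed[of X c] root_comb_closed[of X d]
  by (intro eq_vecI) (auto simp: root_comb_index intro!: sum.cong)

text \<open>Only the coefficient of \<open>\<alpha>\<^sub>i\<close> changes, since \<open>s\<^sub>i(\<beta>)\<close> differs from \<open>\<beta>\<close> by a
  multiple of \<open>\<alpha>\<^sub>i\<close>.\<close>

lemma root_reflection_simple_root_comb:
  assumes S: "simple_root X ` {1..weyl_rank X} \<subseteq> euclid X" and i: "i \<in> {1..weyl_rank X}"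
  shows "root_reflection X (simple_root X i) (root_comb X c) =
    root_comb X (c(i := c i - 2 * (simple_root X i \<bullet> root_comb X c) /
      (simple_root X i \<bullet> simple_root X i)))"
proof -
  define p where
    "p = 2 * (simple_root X i \<bullet> root_comb X c) / (simple_root X i \<bullet> simple_root X i)"
  have "root_reflection X (simple_root X i) (root_comb X c) =
      root_comb X c - p \<cdot>\<^sub>v root_comb X (\<lambda>k. if k = i then 1 else 0)"
    using root_comb_closed[OF S]
    by (simp add: root_reflection_apply root_comb_single[OF S i] p_def)
  also have "\<dots> = root_comb X (\<lambda>k. c k - p * (if k = i then 1 else 0))"
    by (rule root_comb_diff_smult[OF S])
  also have "(\<lambda>k. c k - p * (if k = i then 1 else 0)) = c(i := c i - p)"
    by auto
  finally show ?thesis unfolding p_def .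
qed

section \<open>Roots, positive roots and simple reflections\<close>

locale simple_system =
  fixes X :: weyl_type and \<Phi> :: "real vec set"
  assumes roots: "root_system X \<Phi>" and simple_roots: "has_simple_roots X \<Phi>"
begin

abbreviation indices :: "nat set" where
  "indices \<equiv> {1..weyl_rank X}"

abbreviation positive :: "real vec set" where
  "positive \<equiv> positive_roots X \<Phi>"

lemma root_in_euclid: "\<alpha> \<in> \<Phi> \<Longrightarrow> \<alpha> \<in> euclid X"
  and root_nonzero: "\<alpha> \<in> \<Phi> \<Longrightarrow> \<alpha> \<noteq> 0\<^sub>v (ambient_dim X)"
  and reflection_root: "\<alpha> \<in> \<Phi> \<Longrightarrow> \<beta> \<in> \<Phi> \<Longrightarrow> root_reflection X \<alpha> \<beta> \<in> \<Phi>"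
  and root_multiple: "\<alpha> \<in> \<Phi> \<Longrightarrow> c \<cdot>\<^sub>v \<alpha> \<in> \<Phi> \<Longrightarrow> c = 1 \<or> c = -1"
  and finite_roots: "finite \<Phi>"
  using roots unfolding root_system_def by blast+

lemma simple_root_root: "i \<in> indices \<Longrightarrow> simple_root X i \<in> \<Phi>"
  using simple_roots unfolding has_simple_roots_def by blast

lemma simple_roots_in_euclid: "simple_root X ` indices \<subseteq> euclid X"
  using simple_root_root root_in_euclid by blast

lemma simple_root_euclid: "i \<in> indices \<Longrightarrow> simple_root X i \<in> euclid X"
  using simple_roots_in_euclid by blast

lemma positive_root: "\<alpha> \<in> positive \<Longrightarrow> \<alpha> \<in> \<Phi>"
  by (simp add: positive_roots_def)

lemma positiveI:
  assumes "\<alpha> \<in> \<Phi>" "\<alpha> = root_comb X c" "\<And>k. k \<in> indices \<Longrightarrow> c k \<ge> 0"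
  shows "\<alpha> \<in> positive"
  unfolding positive_roots_def using assms by (intro CollectI conjI exI[of _ c]) auto

lemma root_comb_inj:
  assumes "root_comb X c = root_comb X d" "k \<in> indices"
  shows "c k = d k"
proof -
  have "root_comb X (\<lambda>k. c k - 1 * d k) = root_comb X d - 1 \<cdot>\<^sub>v root_comb X d"
    using root_comb_diff_smult[OF simple_roots_in_euclid, of c 1 d] assms by simp
  also have "\<dots> = 0\<^sub>v (ambient_dim X)"
    using root_comb_closed[OF simple_roots_in_euclid, of d] by auto
  finally have "\<forall>k\<in>indices. c k - 1 * d k = 0"
    using simple_roots unfolding has_simple_roots_def by blast
  then show ?thesis using assms(2) by simp
qed

lemma uminus_root:
  assumes "\<alpha> \<in> \<Phi>" shows "- \<alpha> \<in> \<Phi>"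
  using reflection_root[OF assms assms] root_reflection_self[of \<alpha> X] assms
  by (simp add: root_in_euclid root_nonzero)

lemma uminus_root_comb: "- root_comb X c = root_comb X (\<lambda>k. - c k)"
proof -
  have "- root_comb X c = (-1) \<cdot>\<^sub>v root_comb X c" by auto
  then show ?thesis using root_comb_smult[OF simple_roots_in_euclid, of "-1" c] by simp
qed

lemma integer_coefficients:
  assumes "\<alpha> \<in> \<Phi>"
  obtains c :: "nat \<Rightarrow> int" where "\<alpha> = root_comb X (\<lambda>k. of_int (c k))"
    "(\<forall>k\<in>indices. c k \<ge> 0) \<or> (\<forall>k\<in>indices. c k \<le> 0)"
  using simple_roots assms unfolding has_simple_roots_def by blast

lemma positive_or_negative:
  assumes "\<alpha> \<in> \<Phi>" shows "\<alpha> \<in> positive \<or> - \<alpha> \<in> positive"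
proof -
  obtain c :: "nat \<Rightarrow> int" where c: "\<alpha> = root_comb X (\<lambda>k. of_int (c k))"
    "(\<forall>k\<in>indices. c k \<ge> 0) \<or> (\<forall>k\<in>indices. c k \<le> 0)"
    using integer_coefficients[OF assms] .
  from c(2) show ?thesis
  proof
    assume "\<forall>k\<in>indices. c k \<ge> 0"
    then have "\<alpha> \<in> positive" by (intro positiveI[OF assms c(1)]) simp
    then show ?thesis ..
  next
    assume "\<forall>k\<in>indices. c k \<le> 0"
    moreover have "- \<alpha> = root_comb X (\<lambda>k. - real_of_int (c k))"
      using c(1) uminus_root_comb by simp
    ultimately have "- \<alpha> \<in> positive" by (intro positiveI[OF uminus_root[OF assms]]) auto
    then show ?thesis ..
  qed
qed

text \<open>Simple-root coordinates are unique, so a root with both signs would be zero.\<close>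

lemma positive_asym:
  assumes "\<alpha> \<in> positive" shows "- \<alpha> \<notin> positive"
proof
  assume "- \<alpha> \<in> positive"
  then obtain d where d: "\<forall>k\<in>indices. d k \<ge> 0" "- \<alpha> = root_comb X d"
    unfolding positive_roots_def by blast
  obtain c where c: "\<forall>k\<in>indices. c k \<ge> 0" "\<alpha> = root_comb X c"
    using assms unfolding positive_roots_def by blast
  have "root_comb X d = root_comb X (\<lambda>k. - c k)" using c d uminus_root_comb by simp
  then have *: "d k = - c k" if "k \<in> indices" for k using root_comb_inj that by blast
  have "c k = 0" if "k \<in> indices" for k
    using *[OF that] c(1) d(1) that by (smt (verit))
  then have "root_comb X c = root_comb X (\<lambda>k. 0 * c k)"
    using root_comb_cong[OF _ simple_roots_in_euclid, of c "\<lambda>k. 0 * c k"] by simp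
  also have "\<dots> = 0 \<cdot>\<^sub>v root_comb X c"
    by (rule root_comb_smult[OF simple_roots_in_euclid, symmetric])
  also have "\<dots> = 0\<^sub>v (ambient_dim X)"
    using root_comb_closed[OF simple_roots_in_euclid, of c] by auto
  finally have "\<alpha> = 0\<^sub>v (ambient_dim X)" using c by simp
  then show False using assms positive_root root_nonzero by blast
qed

lemma simple_root_positive:
  assumes "i \<in> indices" shows "simple_root X i \<in> positive"
  by (rule positiveI[OF simple_root_root[OF assms]
        root_comb_single[OF simple_roots_in_euclid assms, symmetric]]) simp

lemma natural_coefficients:
  assumes "\<alpha> \<in> positive"
  obtains c :: "nat \<Rightarrow> nat" where "\<alpha> = root_comb X (\<lambda>k. of_nat (c k))"
proof -
  obtain c :: "nat \<Rightarrow> int" where c: "\<alpha> = root_comb X (\<lambda>k. of_int (c k))"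
    using integer_coefficients[OF positive_root[OF assms]] by blast
  obtain d where d: "\<forall>k\<in>indices. d k \<ge> 0" "\<alpha> = root_comb X d"
    using assms unfolding positive_roots_def by blast
  have "c k \<ge> 0" if "k \<in> indices" for k
    using root_comb_inj[of "\<lambda>k. of_int (c k)" d k] c d that
    by (metis of_int_0_le_iff)
  then have "root_comb X (\<lambda>k. of_int (c k)) = root_comb X (\<lambda>k. of_nat (nat (c k)))"
    by (intro root_comb_cong simple_roots_in_euclid) simp
  then show thesis using that[of "\<lambda>k. nat (c k)"] c by simp
qed

text \<open>A positive root other than \<open>\<alpha>\<^sub>i\<close> has a positive coefficient at some \<open>\<alpha>\<^sub>k\<close> with
  \<open>k \<noteq> i\<close>, because the root system is reduced; \<open>s\<^sub>i\<close> leaves that coefficient alone, and one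
  positive coefficient decides the sign of a root.\<close>

lemma simple_reflection_positive:
  assumes i: "i \<in> indices" and \<beta>: "\<beta> \<in> positive" and ne: "\<beta> \<noteq> simple_root X i"
  shows "simple_reflection X i \<beta> \<in> positive"
proof -
  obtain c where c: "\<forall>k\<in>indices. c k \<ge> 0" "\<beta> = root_comb X c"
    using \<beta> unfolding positive_roots_def by blast
  define c' where "c' = c(i := c i - 2 * (simple_root X i \<bullet> root_comb X c) /
      (simple_root X i \<bullet> simple_root X i))"
  have s: "simple_reflection X i \<beta> = root_comb X c'"
    unfolding simple_reflection_def c(2) c'_def
    by (rule root_reflection_simple_root_comb[OF simple_roots_in_euclid i])
  have "simple_reflection X i \<beta> \<in> \<Phi>"
    unfolding simple_reflection_def using reflection_root simple_root_root i positive_root \<beta> by blast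
  then consider "simple_reflection X i \<beta> \<in> positive" | "- simple_reflection X i \<beta> \<in> positive"
    using positive_or_negative by blast
  then show ?thesis
  proof cases
    case 2
    then obtain d where d: "\<forall>k\<in>indices. d k \<ge> 0" "- root_comb X c' = root_comb X d"
      unfolding positive_roots_def s by blast
    have "c k = 0" if "k \<in> indices" "k \<noteq> i" for k
    proof -
      have "- c' k = d k"
        using root_comb_inj[of "\<lambda>k. - c' k" d k] d(2) uminus_root_comb that by simp
      then show ?thesis
        using that c(1) d(1)
        by (simp add: c'_def)
          (metis order_antisym neg_0_le_iff_le atLeastAtMost_iff One_nat_def)
    qed
    then have "root_comb X c = root_comb X (\<lambda>k. c i * (if k = i then 1 else 0))"
      by (intro root_comb_cong simple_roots_in_euclid) auto
    also have "\<dots> = c i \<cdot>\<^sub>v simple_root X i"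
      using root_comb_smult[OF simple_roots_in_euclid, symmetric]
        root_comb_single[OF simple_roots_in_euclid i] by simp
    finally have \<beta>i: "\<beta> = c i \<cdot>\<^sub>v simple_root X i" using c by simp
    then have "c i = 1 \<or> c i = -1"
      using root_multiple[OF simple_root_root[OF i]] positive_root[OF \<beta>] by simp
    then have "c i = 1" using c(1) i by (smt (verit))
    then show ?thesis using \<beta>i ne by simp
  qed simp
qed

lemma finite_positive: "finite positive"
  using finite_roots unfolding positive_roots_def by simp

text \<open>Descending induction on the height. A positive root pairs positively with itself,
  hence with some simple root \<open>\<alpha>\<^sub>k\<close>, and unless it equals \<open>\<alpha>\<^sub>k\<close>, the reflection \<open>s\<^sub>k\<close> turns it
  into a positive root of smaller height, from which \<open>s\<^sub>k\<close> climbs back.\<close>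

lemma positive_roots_minimal:
  assumes base: "simple_root X ` indices \<subseteq> L"
    and step: "\<And>\<beta> i. \<beta> \<in> L \<Longrightarrow> \<beta> \<in> positive \<Longrightarrow> i \<in> indices \<Longrightarrow> simple_root X i \<bullet> \<beta> < 0 \<Longrightarrow>
      simple_reflection X i \<beta> \<in> L"
  shows "positive \<subseteq> L"
proof
  fix \<beta> assume "\<beta> \<in> positive"
  then obtain c :: "nat \<Rightarrow> nat" where "\<beta> = root_comb X (\<lambda>k. of_nat (c k))"
    using natural_coefficients by blast
  then show "\<beta> \<in> L" using \<open>\<beta> \<in> positive\<close>
  proof (induction "sum c indices" arbitrary: \<beta> c rule: less_induct)
    case less
    have \<beta>: "\<beta> \<in> euclid X" "\<beta> \<bullet> \<beta> > 0"
      using less.prems positive_root root_in_euclid root_nonzero scalar_prod_self_pos by blast+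
    \<comment> \<open>Otherwise \<open>(\<beta>, \<beta>)\<close>, a nonnegative combination of the \<open>(\<beta>, \<alpha>\<^sub>k)\<close>, would not be positive.\<close>
    have "\<exists>k\<in>indices. simple_root X k \<bullet> \<beta> > 0"
    proof (rule ccontr)
      assume "\<not> ?thesis"
      then have "\<beta> \<bullet> simple_root X k \<le> 0" if "k \<in> indices" for k
        using that comm_scalar_prod[OF \<beta>(1) simple_root_euclid[OF that]] by force
      then have "(\<Sum>k\<in>indices. of_nat (c k) * (\<beta> \<bullet> simple_root X k)) \<le> 0"
        by (intro sum_nonpos) (simp add: mult_nonneg_nonpos)
      then show False
        using \<beta>(2) scalar_prod_root_comb[OF simple_roots_in_euclid \<beta>(1), of "\<lambda>k. of_nat (c k)"]
        by (simp flip: less.prems(1))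
    qed
    then obtain k where k: "k \<in> indices" "simple_root X k \<bullet> \<beta> > 0" by blast
    show ?case
    proof (cases "\<beta> = simple_root X k")
      case True
      then show ?thesis using base k by blast
    next
      case False
      define \<gamma> where "\<gamma> = simple_reflection X k \<beta>"
      have \<gamma>: "\<gamma> \<in> positive"
        unfolding \<gamma>_def by (rule simple_reflection_positive[OF k(1) less.prems(2) False])
      have ak: "simple_root X k \<in> euclid X" "simple_root X k \<noteq> 0\<^sub>v (ambient_dim X)"
        "simple_root X k \<bullet> simple_root X k > 0"
        using simple_root_root[OF k(1)] root_in_euclid root_nonzero scalar_prod_self_pos by blast+
      obtain d :: "nat \<Rightarrow> nat" where d: "\<gamma> = root_comb X (\<lambda>k. of_nat (d k))"
        using natural_coefficients \<gamma> by blast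
      have "\<gamma> = root_comb X ((\<lambda>k. of_nat (c k))(k := of_nat (c k) -
          2 * (simple_root X k \<bullet> \<beta>) / (simple_root X k \<bullet> simple_root X k)))"
        unfolding \<gamma>_def simple_reflection_def less.prems(1)
        by (rule root_reflection_simple_root_comb[OF simple_roots_in_euclid k(1)])
      then have dj: "real (d j) = ((\<lambda>k. of_nat (c k))(k := of_nat (c k) -
          2 * (simple_root X k \<bullet> \<beta>) / (simple_root X k \<bullet> simple_root X k))) j"
        if "j \<in> indices" for j
        using root_comb_inj[OF _ that, of "\<lambda>k. of_nat (d k)"] d by metis
      have "real (d k) < real (c k)" using dj[OF k(1)] k(2) ak(3) by simp
      moreover have "d j = c j" if "j \<in> indices" "j \<noteq> k" for j using dj[OF that(1)] that(2) by simp
      ultimately have "sum d indices < sum c indices"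
        using k(1) by (intro sum_strict_mono_ex1)
            (auto intro: le_eq_less_or_eq[THEN iffD2] dest: leI, metis less_or_eq_imp_le)
      then have "\<gamma> \<in> L" using less.hyps[OF _ d \<gamma>] by simp
      moreover have "simple_root X k \<bullet> \<gamma> = - (simple_root X k \<bullet> \<beta>)"
        using ak \<beta>(1) by (simp add: \<gamma>_def simple_reflection_def scalar_prod_root_reflection)
      ultimately have "simple_reflection X k \<gamma> \<in> L" using step[OF _ \<gamma> k(1)] k(2) by simp
      then show ?thesis
        using ak \<beta>(1) by (simp add: \<gamma>_def simple_reflection_def root_reflection_involution)
    qed
  qed
qed


section \<open>The Weyl group as a group of words\<close>

lemma simple_reflection_Bij:
  "i \<in> indices \<Longrightarrow> simple_reflection X i \<in> Bij (euclid X)"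
  unfolding simple_reflection_def
  using root_reflection_Bij simple_root_root root_in_euclid root_nonzero by blast

lemma weyl_group_group: "group (weyl_group X)"
  unfolding weyl_group_def by (rule group.group_subgroup_generated[OF group_BijGroup])

lemma weyl_group_Bij: "w \<in> carrier (weyl_group X) \<Longrightarrow> w \<in> Bij (euclid X)"
  unfolding weyl_group_def
  using group.carrier_subgroup_generated_subset[OF group_BijGroup]
  by (force simp: BijGroup_def)

lemma simple_reflection_carrier:
  assumes "i \<in> indices" shows "simple_reflection X i \<in> carrier (weyl_group X)"
  unfolding weyl_group_def carrier_subgroup_generated
  by (rule generate.incl)
     (use simple_reflection_Bij[OF assms] assms in \<open>auto simp: BijGroup_def simple_reflections_def\<close>)

lemma weyl_mult_apply:
  assumes "f \<in> carrier (weyl_group X)" "g \<in> carrier (weyl_group X)" "\<beta> \<in> euclid X"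
  shows "(f \<otimes>\<^bsub>weyl_group X\<^esub> g) \<beta> = f (g \<beta>)"
  using weyl_group_Bij[OF assms(1)] weyl_group_Bij[OF assms(2)] assms(3)
  by (simp add: weyl_group_def mult_subgroup_generated BijGroup_def compose_def)

lemma weyl_one_apply: "\<beta> \<in> euclid X \<Longrightarrow> \<one>\<^bsub>weyl_group X\<^esub> \<beta> = \<beta>"
  by (simp add: weyl_group_def one_subgroup_generated BijGroup_def)

lemma weyl_eqI:
  assumes "f \<in> Bij (euclid X)" "g \<in> Bij (euclid X)" "\<And>\<beta>. \<beta> \<in> euclid X \<Longrightarrow> f \<beta> = g \<beta>"
  shows "f = g"
  by (rule extensionalityI[of _ "euclid X"]) (use assms Bij_imp_extensional in auto)

lemma simple_reflection_involution:
  assumes "i \<in> indices" "\<beta> \<in> euclid X"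
  shows "simple_reflection X i (simple_reflection X i \<beta>) = \<beta>"
  unfolding simple_reflection_def
  using assms simple_root_root root_in_euclid root_nonzero by (intro root_reflection_involution) auto

lemma simple_reflection_inv:
  assumes "i \<in> indices"
  shows "inv\<^bsub>weyl_group X\<^esub> (simple_reflection X i) = simple_reflection X i"
proof (rule group.inv_equality[OF weyl_group_group])
  interpret W: group "weyl_group X" by (rule weyl_group_group)
  show "simple_reflection X i \<otimes>\<^bsub>weyl_group X\<^esub> simple_reflection X i = \<one>\<^bsub>weyl_group X\<^esub>"
    by (rule weyl_eqI)
       (use assms simple_reflection_carrier simple_reflection_involution in
          \<open>auto intro!: weyl_group_Bij simp: weyl_mult_apply weyl_one_apply\<close>)
qed (use assms simple_reflection_carrier in auto)

lemma word_prod_carrier: "is_word X u \<Longrightarrow> word_prod X u \<in> carrier (weyl_group X)"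
proof (induction u)
  case Nil
  interpret W: group "weyl_group X" by (rule weyl_group_group)
  show ?case by (simp add: word_prod_def)
next
  case (Cons i u)
  interpret W: group "weyl_group X" by (rule weyl_group_group)
  show ?case using Cons simple_reflection_carrier by (auto simp: word_prod_def is_word_def)
qed

lemma word_prod_Cons:
  "word_prod X (i # u) = simple_reflection X i \<otimes>\<^bsub>weyl_group X\<^esub> word_prod X u"
  by (simp add: word_prod_def)

lemma word_prod_append:
  assumes "is_word X u" "is_word X v"
  shows "word_prod X (u @ v) = word_prod X u \<otimes>\<^bsub>weyl_group X\<^esub> word_prod X v"
  using assms
proof (induction u)
  case Nil
  interpret W: group "weyl_group X" by (rule weyl_group_group)
  show ?case using Nil word_prod_carrier by (simp add: word_prod_def)
next
  case (Cons i u)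
  interpret W: group "weyl_group X" by (rule weyl_group_group)
  have "i \<in> indices" "is_word X u" using Cons.prems by (auto simp: is_word_def)
  then show ?case
    using Cons by (simp add: word_prod_Cons W.m_assoc simple_reflection_carrier word_prod_carrier)
qed

lemma word_prod_Nil_apply: "\<beta> \<in> euclid X \<Longrightarrow> word_prod X [] \<beta> = \<beta>"
  by (simp add: word_prod_def weyl_one_apply)

lemma word_prod_Cons_apply:
  assumes "i \<in> indices" "is_word X u" "\<beta> \<in> euclid X"
  shows "word_prod X (i # u) \<beta> = simple_reflection X i (word_prod X u \<beta>)"
  using assms by (simp add: word_prod_Cons weyl_mult_apply simple_reflection_carrier word_prod_carrier)

lemma weyl_group_word:
  assumes "w \<in> carrier (weyl_group X)"
  obtains u where "is_word X u" "w = word_prod X u"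
proof -
  interpret W: group "weyl_group X" by (rule weyl_group_group)
  have 1: "\<exists>u. is_word X u \<and> simple_reflection X i = word_prod X u" if "i \<in> indices" for i
    by (rule exI[of _ "[i]"])
       (use that simple_reflection_carrier in \<open>auto simp: is_word_def word_prod_def\<close>)
  have "w \<in> generate (BijGroup (euclid X)) (carrier (BijGroup (euclid X)) \<inter> simple_reflections X)"
    using assms unfolding weyl_group_def carrier_subgroup_generated .
  then have "\<exists>u. is_word X u \<and> w = word_prod X u"
  proof induction
    case one
    have "is_word X [] \<and> \<one>\<^bsub>BijGroup (euclid X)\<^esub> = word_prod X []"
      by (simp add: is_word_def word_prod_def weyl_group_def one_subgroup_generated)
    then show ?case by blast
  next
    case (incl h)
    then show ?case using 1 by (auto simp: simple_reflections_def)
  next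
    case (inv h)
    then obtain i where i: "i \<in> indices" "h = simple_reflection X i"
      by (auto simp: simple_reflections_def)
    have "inv\<^bsub>BijGroup (euclid X)\<^esub> h = inv\<^bsub>weyl_group X\<^esub> h"
      using simple_reflection_carrier[OF i(1)] unfolding weyl_group_def i(2)
      by (simp add: group.inv_subgroup_generated[OF group_BijGroup])
    then show ?case using 1[OF i(1)] i simple_reflection_inv by simp
  next
    case (eng h1 h2)
    then obtain u v where "is_word X u" "h1 = word_prod X u" "is_word X v" "h2 = word_prod X v"
      by blast
    then have "is_word X (u @ v) \<and> h1 \<otimes>\<^bsub>BijGroup (euclid X)\<^esub> h2 = word_prod X (u @ v)"
      using word_prod_append[of u v]
      by (simp add: is_word_def weyl_group_def mult_subgroup_generated)
    then show ?case by blast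
  qed
  then show thesis using that by blast
qed

lemma word_prod_root:
  assumes "is_word X u" "\<beta> \<in> \<Phi>" shows "word_prod X u \<beta> \<in> \<Phi>"
  using assms
proof (induction u)
  case Nil
  then show ?case by (simp add: word_prod_Nil_apply root_in_euclid)
next
  case (Cons i u)
  then have "i \<in> indices" "is_word X u" by (auto simp: is_word_def)
  then show ?case
    using Cons reflection_root simple_root_root
    by (simp add: word_prod_Cons_apply root_in_euclid simple_reflection_def)
qed

lemma simple_reflection_conj:
  assumes i: "i \<in> indices" and \<beta>: "\<beta> \<in> \<Phi>" and r: "root_reflection X \<beta> \<in> carrier (weyl_group X)"
  shows "simple_reflection X i \<otimes>\<^bsub>weyl_group X\<^esub> root_reflection X \<beta> \<otimes>\<^bsub>weyl_group X\<^esub> simple_reflection X i =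
    root_reflection X (simple_reflection X i \<beta>)"
    (is "?s \<otimes>\<^bsub>_\<^esub> ?r \<otimes>\<^bsub>_\<^esub> _ = _")
proof (rule weyl_eqI)
  interpret W: group "weyl_group X" by (rule weyl_group_group)
  note s = simple_reflection_carrier[OF i]
  show "?s \<otimes>\<^bsub>weyl_group X\<^esub> ?r \<otimes>\<^bsub>weyl_group X\<^esub> ?s \<in> Bij (euclid X)"
    using s r by (intro weyl_group_Bij) simp
  have "?s \<beta> \<in> \<Phi>"
    using \<beta> simple_root_root[OF i] reflection_root by (simp add: simple_reflection_def)
  then show "root_reflection X (?s \<beta>) \<in> Bij (euclid X)"
    using root_reflection_Bij root_in_euclid root_nonzero by blast
  fix \<gamma> assume \<gamma>: "\<gamma> \<in> euclid X"
  then have "?s \<gamma> \<in> euclid X"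
    using simple_root_euclid[OF i] by (simp add: simple_reflection_def)
  then have "(?s \<otimes>\<^bsub>weyl_group X\<^esub> ?r \<otimes>\<^bsub>weyl_group X\<^esub> ?s) \<gamma> = ?s (?r (?s \<gamma>))"
    using s r \<gamma> by (simp add: weyl_mult_apply)
  also have "\<dots> = root_reflection X (?s \<beta>) \<gamma>"
    unfolding simple_reflection_def
    using \<beta> \<gamma> simple_root_root[OF i] root_in_euclid root_nonzero
    by (intro root_reflection_conj) auto
  finally show "(?s \<otimes>\<^bsub>weyl_group X\<^esub> ?r \<otimes>\<^bsub>weyl_group X\<^esub> ?s) \<gamma> = root_reflection X (?s \<beta>) \<gamma>" .
qed

text \<open>Conjugating a reflection by a group element reflects in the transported root. By induction
  along the word it suffices to conjugate by one simple reflection at a time.\<close>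

lemma root_reflection_word_prod:
  assumes "is_word X u" "k \<in> indices"
  shows "root_reflection X (word_prod X u (simple_root X k)) =
    word_prod X u \<otimes>\<^bsub>weyl_group X\<^esub> simple_reflection X k \<otimes>\<^bsub>weyl_group X\<^esub>
      inv\<^bsub>weyl_group X\<^esub> (word_prod X u)"
  using assms(1)
proof (induction u)
  case Nil
  interpret W: group "weyl_group X" by (rule weyl_group_group)
  have "word_prod X [] = \<one>\<^bsub>weyl_group X\<^esub>" by (simp add: word_prod_def)
  then show ?case
    using assms simple_reflection_carrier simple_root_euclid
    by (simp add: weyl_one_apply) (simp add: simple_reflection_def)
next
  case (Cons i u)
  interpret W: group "weyl_group X" by (rule weyl_group_group)
  have i: "i \<in> indices" and u: "is_word X u" using Cons.prems by (auto simp: is_word_def)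
  let ?s = "simple_reflection X i" and ?w = "word_prod X u" and ?t = "simple_reflection X k"
  let ?b = "word_prod X u (simple_root X k)"
  note c = simple_reflection_carrier[OF i] simple_reflection_carrier[OF assms(2)] word_prod_carrier[OF u]
  have b: "?b \<in> \<Phi>" using word_prod_root[OF u] simple_root_root assms(2) by blast
  have IH: "root_reflection X ?b = ?w \<otimes>\<^bsub>weyl_group X\<^esub> ?t \<otimes>\<^bsub>weyl_group X\<^esub> inv\<^bsub>weyl_group X\<^esub> ?w"
    using Cons u by blast
  then have cb: "root_reflection X ?b \<in> carrier (weyl_group X)" using c by simp
  have "word_prod X (i # u) \<otimes>\<^bsub>weyl_group X\<^esub> ?t \<otimes>\<^bsub>weyl_group X\<^esub> inv\<^bsub>weyl_group X\<^esub> (word_prod X (i # u)) =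
      ?s \<otimes>\<^bsub>weyl_group X\<^esub> root_reflection X ?b \<otimes>\<^bsub>weyl_group X\<^esub> ?s"
    using c by (simp add: word_prod_Cons IH W.inv_mult_group W.m_assoc simple_reflection_inv[OF i])
  also have "\<dots> = root_reflection X (simple_reflection X i ?b)"
    by (rule simple_reflection_conj[OF i b cb])
  finally show ?case using i u assms(2) by (simp add: word_prod_Cons_apply simple_root_euclid)
qed

text \<open>A reflection determines the line that it negates, and a reduced root system has only one
  positive root on each of its lines.\<close>

lemma root_reflection_inj:
  assumes "\<alpha> \<in> positive" "\<beta> \<in> positive" "root_reflection X \<alpha> = root_reflection X \<beta>"
  shows "\<alpha> = \<beta>"
proof -
  have a: "\<alpha> \<in> \<Phi>" "\<alpha> \<in> euclid X" "\<alpha> \<noteq> 0\<^sub>v (ambient_dim X)"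
    and b: "\<beta> \<in> \<Phi>" "\<beta> \<in> euclid X"
    using assms positive_root root_in_euclid root_nonzero by blast+
  define c where "c = (\<beta> \<bullet> \<alpha>) / (\<beta> \<bullet> \<beta>)"
  have "- \<alpha> = root_reflection X \<beta> \<alpha>" using root_reflection_self[OF a(2,3)] assms(3) by simp
  then have *: "- \<alpha> = \<alpha> - (2 * c) \<cdot>\<^sub>v \<beta>" using a(2) by (simp add: root_reflection_apply c_def)
  have "\<alpha> = c \<cdot>\<^sub>v \<beta>"
  proof (rule eq_vecI)
    fix j assume "j < dim_vec (c \<cdot>\<^sub>v \<beta>)"
    then have j: "j < dim_vec \<alpha>" "j < dim_vec \<beta>" using a b by auto
    have "(- \<alpha>) $ j = (\<alpha> - (2 * c) \<cdot>\<^sub>v \<beta>) $ j" using * by simp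
    then show "\<alpha> $ j = (c \<cdot>\<^sub>v \<beta>) $ j" using j by simp
  qed (use a b in auto)
  moreover from this have "c = 1 \<or> c = -1" using root_multiple[OF b(1)] a(1) by simp
  moreover have "(-1) \<cdot>\<^sub>v \<beta> = - \<beta>" by auto
  ultimately show ?thesis using positive_asym[OF assms(2)] assms(1) by auto
qed


section \<open>Inversions bound the length from below\<close>

definition inversions :: "(real vec \<Rightarrow> real vec) \<Rightarrow> real vec set" where
  "inversions g = {\<beta> \<in> positive. g \<beta> \<notin> positive}"

lemma finite_inversions: "finite (inversions g)"
  unfolding inversions_def using finite_positive by simp

text \<open>Multiplying by \<open>s\<^sub>i\<close> on the left creates at most one inversion, namely the preimage
  of \<open>\<alpha>\<^sub>i\<close>: every other positive root stays positive under \<open>s\<^sub>i\<close>.\<close>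

lemma card_inversions_le_length:
  assumes "is_word X u" shows "card (inversions (word_prod X u)) \<le> length u"
  using assms
proof (induction u)
  case Nil
  have "inversions (word_prod X []) = {}"
    by (auto simp: inversions_def word_prod_Nil_apply positive_root root_in_euclid)
  then show ?case by simp
next
  case (Cons i u)
  have i: "i \<in> indices" and u: "is_word X u" using Cons.prems by (auto simp: is_word_def)
  \<comment> \<open>The only possible new inversion; \<open>P\<close> has at most one element by injectivity.\<close>
  define P where "P = {\<beta> \<in> positive. word_prod X u \<beta> = simple_root X i}"
  have "inj_on (word_prod X u) (euclid X)"
    using weyl_group_Bij[OF word_prod_carrier[OF u]] by (simp add: Bij_def bij_betw_def)
  then have "\<beta> = \<gamma>" if "\<beta> \<in> P" "\<gamma> \<in> P" for \<beta> \<gamma>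
    using that positive_root root_in_euclid unfolding P_def inj_on_def by auto
  then have P: "card P \<le> 1"
    using card_le_Suc0_iff_eq[of P] finite_positive by (auto simp: P_def)
  have "inversions (word_prod X (i # u)) \<subseteq> inversions (word_prod X u) \<union> P"
  proof
    fix \<beta> assume \<beta>: "\<beta> \<in> inversions (word_prod X (i # u))"
    then have "word_prod X (i # u) \<beta> = simple_reflection X i (word_prod X u \<beta>)"
      using word_prod_Cons_apply[OF i u] positive_root root_in_euclid by (auto simp: inversions_def)
    then show "\<beta> \<in> inversions (word_prod X u) \<union> P"
      using \<beta> simple_reflection_positive[OF i] by (auto simp: inversions_def P_def)
  qed
  then have "card (inversions (word_prod X (i # u))) \<le> card (inversions (word_prod X u) \<union> P)"
    using finite_positive finite_inversions by (intro card_mono) (auto simp: P_def)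
  also have "\<dots> \<le> card (inversions (word_prod X u)) + card P" by (rule card_Un_le)
  finally show ?case using Cons.IH[OF u] P by simp
qed

end

text \<open>An ascending palindrome for \<open>\<beta>\<close> starts with a simple root and wraps further letters
  around its centre, each of which reflects the current root upwards: a negative product
  with \<open>\<alpha>\<^sub>i\<close> means that \<open>s\<^sub>i\<close> adds a positive multiple of \<open>\<alpha>\<^sub>i\<close>.\<close>

inductive ascending_palindrome :: "weyl_type \<Rightarrow> nat list \<Rightarrow> real vec \<Rightarrow> bool" for X where
  centre: "k \<in> {1..weyl_rank X} \<Longrightarrow> ascending_palindrome X [k] (simple_root X k)"
| wrap: "ascending_palindrome X u \<beta> \<Longrightarrow> i \<in> {1..weyl_rank X} \<Longrightarrow> simple_root X i \<bullet> \<beta> < 0 \<Longrightarrow>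
    ascending_palindrome X ([i] @ u @ [i]) (simple_reflection X i \<beta>)"

lemma ascending_palindrome_palindromic: "ascending_palindrome X u \<beta> \<Longrightarrow> palindromic u"
  by (induction rule: ascending_palindrome.induct) (auto simp: palindromic_def)

lemma ascending_palindrome_is_word: "ascending_palindrome X u \<beta> \<Longrightarrow> is_word X u"
  by (induction rule: ascending_palindrome.induct) (auto simp: is_word_def)

context simple_system
begin

lemma not_simple_root_if_negative_product:
  assumes "i \<in> indices" "simple_root X i \<bullet> \<beta> < 0"
  shows "\<beta> \<noteq> simple_root X i"
  using assms simple_root_root root_in_euclid root_nonzero
    scalar_prod_self_pos[of "simple_root X i" "ambient_dim X"] by force

lemma ascending_palindrome_positive:
  "ascending_palindrome X u \<beta> \<Longrightarrow> \<beta> \<in> positive"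
proof (induction rule: ascending_palindrome.induct)
  case (wrap u \<beta> i)
  then show ?case using simple_reflection_positive not_simple_root_if_negative_product by blast
qed (rule simple_root_positive)

text \<open>The first half of the word carries the simple root at the centre to \<open>\<beta>\<close>; this makes \<open>s\<^sub>\<beta>\<close> a
  conjugate of a simple reflection.\<close>

lemma ascending_palindrome_orbit:
  assumes "ascending_palindrome X u \<beta>"
  obtains v k where "is_word X v" "k \<in> indices" "\<beta> = word_prod X v (simple_root X k)"
proof -
  from assms have "\<exists>v k. is_word X v \<and> k \<in> indices \<and> \<beta> = word_prod X v (simple_root X k)"
  proof (induction rule: ascending_palindrome.induct)
    case (centre k)
    then have "is_word X [] \<and> k \<in> indices \<and> simple_root X k = word_prod X [] (simple_root X k)"
      by (simp add: is_word_def word_prod_Nil_apply simple_root_euclid)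
    then show ?case by blast
  next
    case (wrap u \<beta> i)
    then obtain v k where v: "is_word X v" "k \<in> indices" "\<beta> = word_prod X v (simple_root X k)"
      by blast
    then have "is_word X (i # v) \<and> k \<in> indices \<and>
        simple_reflection X i \<beta> = word_prod X (i # v) (simple_root X k)"
      using wrap.hyps by (simp add: word_prod_Cons_apply simple_root_euclid) (simp add: is_word_def)
    then show ?case by blast
  qed
  then show thesis using that by blast
qed

lemma ascending_palindrome_reflection:
  assumes "ascending_palindrome X u \<beta>"
  shows "root_reflection X \<beta> \<in> reflections X" "root_reflection X \<beta> \<in> carrier (weyl_group X)"
proof -
  interpret W: group "weyl_group X" by (rule weyl_group_group)
  obtain v k where v: "is_word X v" "k \<in> indices" "\<beta> = word_prod X v (simple_root X k)"
    using ascending_palindrome_orbit[OF assms] .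
  have s: "simple_reflection X k \<in> simple_reflections X" using v by (simp add: simple_reflections_def)
  show "root_reflection X \<beta> \<in> reflections X"
    unfolding v(3) root_reflection_word_prod[OF v(1,2)] reflections_def
    using word_prod_carrier[OF v(1)] s by blast
  show "root_reflection X \<beta> \<in> carrier (weyl_group X)"
    unfolding v(3) root_reflection_word_prod[OF v(1,2)]
    using word_prod_carrier[OF v(1)] simple_reflection_carrier[OF v(2)] by simp
qed

lemma ascending_palindrome_word_prod:
  "ascending_palindrome X u \<beta> \<Longrightarrow> word_prod X u = root_reflection X \<beta>"
proof (induction rule: ascending_palindrome.induct)
  case (centre k)
  interpret W: group "weyl_group X" by (rule weyl_group_group)
  show ?case
    using simple_reflection_carrier[OF centre] by (simp add: word_prod_def) (simp add: simple_reflection_def)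
next
  case (wrap u \<beta> i)
  interpret W: group "weyl_group X" by (rule weyl_group_group)
  let ?s = "simple_reflection X i"
  have s: "?s \<in> carrier (weyl_group X)" and r: "root_reflection X \<beta> \<in> carrier (weyl_group X)"
    using simple_reflection_carrier wrap ascending_palindrome_reflection by blast+
  have \<beta>: "\<beta> \<in> \<Phi>"
    using ascending_palindrome_positive[OF wrap.hyps(1)] positive_root by blast
  have i: "is_word X [i]" using wrap by (simp add: is_word_def)
  have "word_prod X ([i] @ u @ [i]) = ?s \<otimes>\<^bsub>weyl_group X\<^esub> (word_prod X u \<otimes>\<^bsub>weyl_group X\<^esub> word_prod X [i])"
    using ascending_palindrome_is_word[OF wrap.hyps(1)] i by (simp add: word_prod_Cons word_prod_append)
  also have "\<dots> = ?s \<otimes>\<^bsub>weyl_group X\<^esub> root_reflection X \<beta> \<otimes>\<^bsub>weyl_group X\<^esub> ?s"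
    using s r wrap.IH by (simp add: W.m_assoc) (simp add: word_prod_def)
  also have "\<dots> = root_reflection X (?s \<beta>)"
    by (rule simple_reflection_conj[OF wrap.hyps(2) \<beta> r])
  finally show ?case .
qed

text \<open>Let \<open>g = s\<^sub>\<beta>\<close> and \<open>h = s\<^sub>i g s\<^sub>i\<close> with \<open>\<beta>\<close> and \<open>\<alpha>\<^sub>i\<close> at an obtuse angle. Then \<open>g\<close> adds a
  positive multiple of \<open>\<beta>\<close> to \<open>\<alpha>\<^sub>i\<close>, so \<open>g(\<alpha>\<^sub>i)\<close> is a positive root different from \<open>\<alpha>\<^sub>i\<close>.
  Therefore \<open>s\<^sub>i\<close> maps the inversions of \<open>g\<close> to inversions of \<open>h\<close>, and there are two new
  ones, \<open>\<alpha>\<^sub>i\<close> and \<open>s\<^sub>i g(\<alpha>\<^sub>i)\<close>. Each wrapping thus adds two letters and two inversions.\<close>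

lemma length_le_card_inversions:
  "ascending_palindrome X u \<beta> \<Longrightarrow> length u \<le> card (inversions (root_reflection X \<beta>))"
proof (induction rule: ascending_palindrome.induct)
  case (centre k)
  have "root_reflection X (simple_root X k) (simple_root X k) = - simple_root X k"
    using centre simple_root_root root_in_euclid root_nonzero by (intro root_reflection_self) auto
  then have "simple_root X k \<in> inversions (root_reflection X (simple_root X k))"
    using simple_root_positive[OF centre] positive_asym by (simp add: inversions_def)
  then show ?case
    using finite_inversions by (simp add: Suc_le_eq card_gt_0_iff) blast
next
  case (wrap u \<beta> i)
  have i: "i \<in> indices" using wrap by simp
  define s where "s = simple_reflection X i"
  define a where "a = simple_root X i"
  define g where "g = root_reflection X \<beta>"
  define h where "h = root_reflection X (s \<beta>)"
  have \<beta>: "\<beta> \<in> positive" using ascending_palindrome_positive wrap by blast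
  have E: "\<gamma> \<in> euclid X" if "\<gamma> \<in> \<Phi>" for \<gamma> using that root_in_euclid by blast
  have a: "a \<in> positive" "a \<in> \<Phi>"
    using simple_root_positive[OF i] positive_root by (auto simp: a_def)
  have s\<Phi>: "s \<gamma> \<in> \<Phi>" and ss: "s (s \<gamma>) = \<gamma>" and s_uminus: "s (- \<gamma>) = - s \<gamma>"
    if "\<gamma> \<in> \<Phi>" for \<gamma>
    using that i a reflection_root simple_reflection_involution E root_reflection_uminus[of a X \<gamma>]
    by (auto simp: s_def a_def simple_reflection_def)
  have spos: "s \<gamma> \<in> positive" if "\<gamma> \<in> positive" "\<gamma> \<noteq> a" for \<gamma>
    using simple_reflection_positive[OF i] that by (simp add: s_def a_def)
  have sa: "s a = - a"
    using root_reflection_self[of a X] a E root_nonzero by (simp add: s_def a_def simple_reflection_def)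
  have g\<Phi>: "g \<gamma> \<in> \<Phi>" and gg: "g (g \<gamma>) = \<gamma>" and g_uminus: "g (- \<gamma>) = - g \<gamma>"
    if "\<gamma> \<in> \<Phi>" for \<gamma>
    using that \<beta> positive_root reflection_root root_reflection_involution[of \<beta> X \<gamma>] E root_nonzero
      root_reflection_uminus[of \<beta> X \<gamma>]
    by (auto simp: g_def)
  have h: "h \<gamma> = s (g (s \<gamma>))" if "\<gamma> \<in> \<Phi>" for \<gamma>
    unfolding h_def g_def s_def simple_reflection_def
    using root_reflection_conj[of "simple_root X i" X \<beta> \<gamma>] that E \<beta> positive_root a(2) root_nonzero
    by (simp add: a_def)
  have ga: "g a \<in> positive" "g a \<noteq> a"
  proof -
    define p where "p = - (2 * (\<beta> \<bullet> a) / (\<beta> \<bullet> \<beta>))"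
    have "\<beta> \<bullet> \<beta> > 0" using \<beta> positive_root E root_nonzero scalar_prod_self_pos by blast
    moreover have "\<beta> \<bullet> a < 0"
      using wrap.hyps(3) comm_scalar_prod[of \<beta> "ambient_dim X" a] \<beta> positive_root E a by (simp add: a_def)
    ultimately have p: "p > 0" by (simp add: p_def divide_neg_pos)
    obtain c where c: "\<forall>k\<in>indices. c k \<ge> 0" "\<beta> = root_comb X c"
      using \<beta> unfolding positive_roots_def by blast
    obtain d where d: "\<forall>k\<in>indices. d k \<ge> 0" "a = root_comb X d"
      using a(1) unfolding positive_roots_def by blast
    have eq: "g a = a - (- p) \<cdot>\<^sub>v \<beta>" using E a(2) by (simp add: g_def root_reflection_apply p_def)
    also have "\<dots> = root_comb X (\<lambda>k. d k - (- p) * c k)"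
      unfolding c(2) d(2) by (rule root_comb_diff_smult[OF simple_roots_in_euclid])
    finally show "g a \<in> positive" by (rule positiveI[OF g\<Phi>[OF a(2)]]) (use c(1) d(1) p in simp)
    show "g a \<noteq> a"
    proof
      assume *: "g a = a"
      have "\<beta> \<bullet> g a = \<beta> \<bullet> a - 2 * (\<beta> \<bullet> a) / (\<beta> \<bullet> \<beta>) * (\<beta> \<bullet> \<beta>)"
        unfolding g_def using \<beta> positive_root E a by (intro scalar_prod_root_reflection) auto
      then show False using * \<open>\<beta> \<bullet> \<beta> > 0\<close> \<open>\<beta> \<bullet> a < 0\<close> by simp
    qed
  qed
  have old: "s ` inversions g \<subseteq> inversions h"
  proof
    fix \<delta> assume "\<delta> \<in> s ` inversions g"
    then obtain \<gamma> where \<gamma>: "\<delta> = s \<gamma>" "\<gamma> \<in> positive" "g \<gamma> \<notin> positive"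
      by (auto simp: inversions_def)
    then have \<gamma>\<Phi>: "\<gamma> \<in> \<Phi>" using positive_root by blast
    have "\<gamma> \<noteq> a" using \<gamma> ga by blast
    then have "\<delta> \<in> positive" using spos \<gamma> by simp
    have "h \<delta> = s (g \<gamma>)" using \<gamma> \<gamma>\<Phi> s\<Phi> ss h by simp
    moreover have "s (g \<gamma>) \<notin> positive"
    proof
      assume sg: "s (g \<gamma>) \<in> positive"
      have m: "- g \<gamma> \<in> positive" using positive_or_negative[OF g\<Phi>[OF \<gamma>\<Phi>]] \<gamma> by blast
      show False
      proof (cases "- g \<gamma> = a")
        case True
        have "g a = - (g (g \<gamma>))" using g_uminus[OF g\<Phi>[OF \<gamma>\<Phi>]] True by simp
        then have "g a = - \<gamma>" using gg[OF \<gamma>\<Phi>] by simp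
        then show False using ga(1) positive_asym[OF \<gamma>(2)] by simp
      next
        case False
        then have "s (- g \<gamma>) \<in> positive" using spos m by blast
        then show False using s_uminus[OF g\<Phi>[OF \<gamma>\<Phi>]] positive_asym[OF sg] by simp
      qed
    qed
    ultimately show "\<delta> \<in> inversions h" using \<open>\<delta> \<in> positive\<close> by (simp add: inversions_def)
  qed
  have sga: "s (g a) \<in> positive" using spos ga by blast
  have "h a = - s (g a)"
    using h[OF a(2)] sa g_uminus[OF a(2)] s_uminus[OF g\<Phi>[OF a(2)]] by simp
  then have new1: "a \<in> inversions h"
    using a positive_asym[OF sga] by (simp add: inversions_def)
  have "h (s (g a)) = - a"
    using h[OF s\<Phi>[OF g\<Phi>[OF a(2)]]] ss[OF g\<Phi>[OF a(2)]] gg[OF a(2)] sa by simp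
  then have new2: "s (g a) \<in> inversions h"
    using sga positive_asym[OF a(1)] by (simp add: inversions_def)
  have ne: "s (g a) \<noteq> a"
  proof
    assume "s (g a) = a"
    then have "g a = - a" using ss[OF g\<Phi>[OF a(2)]] sa by simp
    then show False using ga(1) positive_asym[OF a(1)] by simp
  qed
  have inj: "inj_on s (inversions g)"
    by (rule inj_on_inverseI[of _ s]) (use ss positive_root in \<open>auto simp: inversions_def\<close>)
  have "a \<notin> s ` inversions g"
  proof
    assume "a \<in> s ` inversions g"
    then obtain \<gamma> where "\<gamma> \<in> positive" "a = s \<gamma>" by (auto simp: inversions_def)
    then have "\<gamma> = - a" using ss positive_root sa by metis
    then show False using \<open>\<gamma> \<in> positive\<close> positive_asym[OF a(1)] by simp
  qed
  moreover have "s (g a) \<notin> s ` inversions g"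
  proof
    assume "s (g a) \<in> s ` inversions g"
    then obtain \<gamma> where \<gamma>: "\<gamma> \<in> positive" "g \<gamma> \<notin> positive" "s (g a) = s \<gamma>"
      by (auto simp: inversions_def)
    then have "\<gamma> = g a" using ss positive_root g\<Phi> a by metis
    then show False using \<gamma>(2) gg[OF a(2)] a by simp
  qed
  ultimately have "card ({a, s (g a)} \<union> s ` inversions g) = 2 + card (inversions g)"
    using ne inj finite_inversions by (simp add: card_image)
  moreover have "card ({a, s (g a)} \<union> s ` inversions g) \<le> card (inversions h)"
    using old new1 new2 finite_inversions by (intro card_mono) auto
  ultimately show ?case using wrap.IH by (simp add: g_def h_def s_def)
qed

lemma ascending_palindrome_reduced:
  assumes "ascending_palindrome X u \<beta>"
  shows "reduced_expression X u (root_reflection X \<beta>)"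
  unfolding reduced_expression_def
proof (intro conjI allI impI)
  fix v assume "is_word X v \<and> word_prod X v = root_reflection X \<beta>"
  then show "length u \<le> length v"
    using length_le_card_inversions[OF assms] card_inversions_le_length[of v] by simp
qed (use assms ascending_palindrome_is_word ascending_palindrome_word_prod in auto)

text \<open>A reflection \<open>w s\<^sub>k w\<^sup>-\<^sup>1\<close> is the reflection in the root \<open>w(\<alpha>\<^sub>k)\<close>, hence also in its negative.\<close>

lemma reflections_subset: "reflections X \<subseteq> root_reflection X ` positive"
proof
  fix t assume "t \<in> reflections X"
  then obtain w k where w: "w \<in> carrier (weyl_group X)" "k \<in> indices"
    "t = w \<otimes>\<^bsub>weyl_group X\<^esub> simple_reflection X k \<otimes>\<^bsub>weyl_group X\<^esub> inv\<^bsub>weyl_group X\<^esub> w"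
    by (auto simp: reflections_def simple_reflections_def)
  obtain u where u: "is_word X u" "w = word_prod X u" using weyl_group_word[OF w(1)] .
  define \<gamma> where "\<gamma> = word_prod X u (simple_root X k)"
  have t: "t = root_reflection X \<gamma>"
    unfolding \<gamma>_def root_reflection_word_prod[OF u(1) w(2)] using w(3) u(2) by simp
  have \<gamma>: "\<gamma> \<in> \<Phi>" unfolding \<gamma>_def using word_prod_root[OF u(1) simple_root_root[OF w(2)]] .
  then have "t = root_reflection X (- \<gamma>)"
    using t root_reflection_of_uminus root_in_euclid by simp
  then show "t \<in> root_reflection X ` positive"
    using t positive_or_negative[OF \<gamma>] by blast
qed

text \<open>The criterion by which every type is treated: a repetition-free list of ascending
  palindromes is complete as soon as its roots contain the simple roots and are closed under
  upward reflections.\<close>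

lemma reflection_list_criterion:
  assumes asc: "\<And>\<alpha> u. (\<alpha>, u) \<in> set L \<Longrightarrow> ascending_palindrome X u \<alpha>"
    and dist: "distinct (map fst L)"
    and base: "\<And>i. i \<in> indices \<Longrightarrow> simple_root X i \<in> fst ` set L"
    and closed: "\<And>\<beta> i. \<beta> \<in> fst ` set L \<Longrightarrow> i \<in> indices \<Longrightarrow> simple_root X i \<bullet> \<beta> < 0 \<Longrightarrow>
      simple_reflection X i \<beta> \<in> fst ` set L"
  shows "(\<forall>(\<alpha>, u) \<in> set L.
            word_prod X u = root_reflection X \<alpha> \<and> palindromic u \<and>
            reduced_expression X u (root_reflection X \<alpha>)) \<and>
         (distinct (map fst L) \<and> set (map fst L) = positive_roots X \<Phi>) \<and>
         (distinct (map (\<lambda>(\<alpha>, u). root_reflection X \<alpha>) L) \<and>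
          set (map (\<lambda>(\<alpha>, u). root_reflection X \<alpha>) L) = reflections X)"
proof -
  have pos: "fst ` set L = positive"
  proof
    show "fst ` set L \<subseteq> positive" using asc ascending_palindrome_positive by fastforce
    show "positive \<subseteq> fst ` set L" using base closed by (intro positive_roots_minimal) auto
  qed
  have m: "map (\<lambda>(\<alpha>, u). root_reflection X \<alpha>) L = map (root_reflection X) (map fst L)"
    by (simp add: case_prod_unfold)
  have "inj_on (root_reflection X) positive"
    using root_reflection_inj by (auto simp: inj_on_def)
  then have "distinct (map (root_reflection X) (map fst L))"
    using dist pos by (simp only: distinct_map set_map)
  moreover have "root_reflection X ` positive = reflections X"
  proof
    show "root_reflection X ` positive \<subseteq> reflections X"
      unfolding pos[symmetric] using asc ascending_palindrome_reflection(1) by fastforce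
  qed (rule reflections_subset)
  moreover have "\<forall>(\<alpha>, u) \<in> set L. word_prod X u = root_reflection X \<alpha> \<and> palindromic u \<and>
      reduced_expression X u (root_reflection X \<alpha>)"
  proof clarify
    fix \<alpha> u assume "(\<alpha>, u) \<in> set L"
    then have "ascending_palindrome X u \<alpha>" by (rule asc)
    then show "word_prod X u = root_reflection X \<alpha> \<and> palindromic u \<and>
        reduced_expression X u (root_reflection X \<alpha>)"
      using ascending_palindrome_word_prod ascending_palindrome_palindromic
        ascending_palindrome_reduced by blast
  qed
  ultimately show ?thesis
    unfolding m using dist pos by (simp only: set_map simp_thms)
qed

end

section \<open>The classical types in coordinates\<close>

lemma e_closed [simp]: "e N i \<in> carrier_vec N"
  by (simp add: e_def)

lemma dim_e [simp]: "dim_vec (e N i) = N"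
  by (simp add: e_def)

lemma scalar_prod_e:
  "1 \<le> i \<Longrightarrow> i \<le> N \<Longrightarrow> 1 \<le> j \<Longrightarrow> j \<le> N \<Longrightarrow> e N i \<bullet> e N j = (if i = j then 1 else 0)"
  unfolding e_def by (subst scalar_prod_left_unit) auto

lemmas scalar_prod_linear =
  add_scalar_prod_distrib[where 'a = real] scalar_prod_add_distrib[where 'a = real]
  minus_scalar_prod_distrib[where 'a = real] scalar_prod_minus_distrib[where 'a = real]
  smult_scalar_prod_distrib[where 'a = real] scalar_prod_smult_distrib[where 'a = real]

lemma asc_Cons: "a \<le> b \<Longrightarrow> asc a b = a # asc (Suc a) b"
  by (simp add: asc_def upt_conv_Cons)

lemma asc_empty: "b < a \<Longrightarrow> asc a b = []"
  by (simp add: asc_def)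

text \<open>All words of the classical lists are built by climbing along consecutive letters
  \<open>b, b - 1, ..., a\<close> from a shorter ascending palindrome.\<close>

lemma ascending_palindrome_climb:
  assumes "ascending_palindrome X u (\<beta> (Suc b))" and "a \<le> Suc b"
    and step: "\<And>k. a \<le> k \<Longrightarrow> k \<le> b \<Longrightarrow> k \<in> {1..weyl_rank X} \<and>
      simple_root X k \<bullet> \<beta> (Suc k) < 0 \<and> simple_reflection X k (\<beta> (Suc k)) = \<beta> k"
  shows "ascending_palindrome X (asc a b @ u @ desc b a) (\<beta> a)"
  using assms(2) step
proof (induction a rule: inc_induct)
  case base
  then show ?case using assms(1) by (simp add: asc_empty desc_def)
next
  case (step k)
  then have k: "k \<in> {1..weyl_rank X}" "simple_root X k \<bullet> \<beta> (Suc k) < 0"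
    "simple_reflection X k (\<beta> (Suc k)) = \<beta> k" by auto
  have "ascending_palindrome X (asc (Suc k) b @ u @ desc b (Suc k)) (\<beta> (Suc k))"
    using step by simp
  from ascending_palindrome.wrap[OF this k(1,2)] show ?case
    using step(2) k(3) by (simp add: asc_Cons desc_def)
qed

lemma set_double_comprehension:
  "set (concat (map (\<lambda>i. map (f i) (ys i)) xs)) = {f i j | i j. i \<in> set xs \<and> j \<in> set (ys i)}"
  by auto

lemma distinct_double_comprehension:
  assumes "distinct xs" "\<And>i. i \<in> set xs \<Longrightarrow> distinct (ys i)"
    and "\<And>i j i' j'. i \<in> set xs \<Longrightarrow> j \<in> set (ys i) \<Longrightarrow> i' \<in> set xs \<Longrightarrow> j' \<in> set (ys i') \<Longrightarrow>
      f i j = f i' j' \<Longrightarrow> i = i' \<and> j = j'"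
  shows "distinct (concat (map (\<lambda>i. map (f i) (ys i)) xs))"
  using assms
proof (induction xs)
  case (Cons x xs)
  have "distinct (concat (map (\<lambda>i. map (f i) (ys i)) xs))"
  proof (rule Cons.IH)
    fix i j i' j'
    assume "i \<in> set xs" "j \<in> set (ys i)" "i' \<in> set xs" "j' \<in> set (ys i')" "f i j = f i' j'"
    then show "i = i' \<and> j = j'" using Cons.prems(3)[of i j i' j'] by simp
  qed (use Cons.prems in auto)
  moreover have "distinct (map (f x) (ys x))"
    using Cons.prems(2)[of x] Cons.prems(3)[of x _ x] by (auto simp: distinct_map inj_on_def)
  moreover have "set (map (f x) (ys x)) \<inter> set (concat (map (\<lambda>i. map (f i) (ys i)) xs)) = {}"
  proof (rule ccontr)
    assume "\<not> ?thesis"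
    then obtain j i' j' where *: "j \<in> set (ys x)" "i' \<in> set xs" "j' \<in> set (ys i')" "f x j = f i' j'"
      by auto
    then have "x = i'" using Cons.prems(3)[of x j i' j'] by simp
    then show False using * Cons.prems(1) by simp
  qed
  ultimately show ?case by simp
qed simp

text \<open>Equations between short combinations of basis vectors are solved or refuted by taking
  products with the basis vectors that occur in them.\<close>

lemma e_minus_inj:
  assumes "i \<in> {1..N}" "j \<in> {1..N}" "i' \<in> {1..N}" "j' \<in> {1..N}" "i \<noteq> j" "i' \<noteq> j'"
    "e N i - e N j = e N i' - e N j'"
  shows "i = i' \<and> j = j'"
proof -
  have "e N k \<bullet> (e N i - e N j) = e N k \<bullet> (e N i' - e N j')" for k using assms by simp
  from this[of i] this[of j] show ?thesis
    using assms(1-6) by (auto simp: scalar_prod_linear[of _ N] scalar_prod_e split: if_splits)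
qed

lemma e_plus_inj:
  assumes "i \<in> {1..N}" "j \<in> {1..N}" "i' \<in> {1..N}" "j' \<in> {1..N}" "i < j" "i' < j'"
    "e N i + e N j = e N i' + e N j'"
  shows "i = i' \<and> j = j'"
proof -
  have "e N k \<bullet> (e N i + e N j) = e N k \<bullet> (e N i' + e N j')" for k using assms by simp
  from this[of i] this[of j] show ?thesis
    using assms(1-6) by (auto simp: scalar_prod_linear[of _ N] scalar_prod_e split: if_splits)
qed

lemma e_minus_neq_plus:
  assumes "i \<in> {1..N}" "j \<in> {1..N}" "i' \<in> {1..N}" "j' \<in> {1..N}" "i \<noteq> j"
  shows "e N i - e N j \<noteq> e N i' + e N j'"
proof
  assume "e N i - e N j = e N i' + e N j'"
  then have "e N j \<bullet> (e N i - e N j) = e N j \<bullet> (e N i' + e N j')" by simp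
  then show False
    using assms by (auto simp: scalar_prod_linear[of _ N] scalar_prod_e split: if_splits)
qed

lemma e_smult_neq_minus:
  assumes "i \<in> {1..N}" "j \<in> {1..N}" "k \<in> {1..N}" "i \<noteq> j" "c > 0"
  shows "c \<cdot>\<^sub>v e N k \<noteq> e N i - e N j"
proof
  assume "c \<cdot>\<^sub>v e N k = e N i - e N j"
  then have "e N j \<bullet> (c \<cdot>\<^sub>v e N k) = e N j \<bullet> (e N i - e N j)" by simp
  then show False
    using assms by (auto simp: scalar_prod_linear[of _ N] scalar_prod_e split: if_splits)
qed

lemma e_smult_neq_plus:
  assumes "i \<in> {1..N}" "j \<in> {1..N}" "k \<in> {1..N}" "i \<noteq> j"
  shows "c \<cdot>\<^sub>v e N k \<noteq> e N i + e N j"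
proof
  assume "c \<cdot>\<^sub>v e N k = e N i + e N j"
  then have "e N l \<bullet> (c \<cdot>\<^sub>v e N k) = e N l \<bullet> (e N i + e N j)" for l by simp
  from this[of i] this[of j] show False
    using assms by (auto simp: scalar_prod_linear[of _ N] scalar_prod_e split: if_splits)
qed

lemma e_smult_inj:
  assumes "i \<in> {1..N}" "j \<in> {1..N}" "c \<cdot>\<^sub>v e N i = c \<cdot>\<^sub>v e N j" "c > 0"
  shows "i = j"
proof -
  have "e N i \<bullet> (c \<cdot>\<^sub>v e N i) = e N i \<bullet> (c \<cdot>\<^sub>v e N j)" using assms by simp
  then show ?thesis
    using assms(1,2,4) by (auto simp: scalar_prod_linear[of _ N] scalar_prod_e split: if_splits)
qed

definition minus_roots :: "nat \<Rightarrow> real vec set" where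
  "minus_roots n = {e n i - e n j | i j. 1 \<le> i \<and> i < j \<and> j \<le> n}"

definition plus_roots :: "nat \<Rightarrow> real vec set" where
  "plus_roots n = {e n i + e n j | i j. 1 \<le> i \<and> i < j \<and> j \<le> n}"

lemma plus_rootsI: "1 \<le> i \<Longrightarrow> i < j \<Longrightarrow> j \<le> n \<Longrightarrow> e n i + e n j \<in> plus_roots n"
  unfolding plus_roots_def by blast

lemma minus_roots_disjoint_plus_roots: "minus_roots n \<inter> plus_roots n = {}"
proof -
  have False if "\<beta> \<in> minus_roots n" "\<beta> \<in> plus_roots n" for \<beta>
  proof -
    obtain i j where "1 \<le> i" "i < j" "j \<le> n" "\<beta> = e n i - e n j"
      using \<open>\<beta> \<in> minus_roots n\<close> by (auto simp: minus_roots_def)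
    moreover obtain i' j' where "1 \<le> i'" "i' < j'" "j' \<le> n" "\<beta> = e n i' + e n j'"
      using \<open>\<beta> \<in> plus_roots n\<close> by (auto simp: plus_roots_def)
    ultimately show False using e_minus_neq_plus[of i n j i' j'] by simp
  qed
  then show ?thesis by blast
qed

lemma fst_list_minus: "fst ` set (list_minus n) = minus_roots n"
  by (force simp: list_minus_def minus_roots_def)

lemma distinct_list_minus: "distinct (map fst (list_minus n))"
proof -
  have "map fst (list_minus n) =
      concat (map (\<lambda>i. map (\<lambda>j. e n i - e n j) [i + 1..<n + 1]) [1..<n + 1])"
    by (simp add: list_minus_def map_concat comp_def)
  also have "distinct \<dots>"
  proof (rule distinct_double_comprehension)
    fix i j i' j'
    assume "i \<in> set [1..<n + 1]" "j \<in> set [i + 1..<n + 1]" "i' \<in> set [1..<n + 1]"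
      "j' \<in> set [i' + 1..<n + 1]" "e n i - e n j = e n i' - e n j'"
    then show "i = i' \<and> j = j'" using e_minus_inj[of i n j i' j'] by (simp del: upt_Suc)
  qed auto
  finally show ?thesis .
qed

text \<open>What the classical types share: \<open>s\<^sub>k\<close> with \<open>k < N\<close> exchanges the coordinates \<open>k\<close> and
  \<open>k + 1\<close>.\<close>

locale coordinate_type =
  fixes X :: weyl_type and N :: nat
  assumes dim: "ambient_dim X = N"
    and rank: "k \<in> {1..<N} \<Longrightarrow> k \<in> {1..weyl_rank X}"
    and closed: "k \<in> {1..weyl_rank X} \<Longrightarrow> simple_root X k \<in> carrier_vec N"
    and differences: "k \<in> {1..<N} \<Longrightarrow> simple_root X k = e N k - e N (Suc k)"
begin

lemma simple_reflection_linear: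
  assumes "k \<in> {1..weyl_rank X}" "x \<in> carrier_vec N" "y \<in> carrier_vec N"
  shows "simple_reflection X k (x + y) = simple_reflection X k x + simple_reflection X k y"
    and "simple_reflection X k (x - y) = simple_reflection X k x - simple_reflection X k y"
  using assms closed dim
  by (simp_all add: simple_reflection_def root_reflection_add root_reflection_minus)

lemma simple_reflection_smult:
  assumes "k \<in> {1..weyl_rank X}" "x \<in> carrier_vec N"
  shows "simple_reflection X k (c \<cdot>\<^sub>v x) = c \<cdot>\<^sub>v simple_reflection X k x"
  using assms closed dim by (simp add: simple_reflection_def root_reflection_smult)

lemma scalar_prod_difference:
  assumes "k \<in> {1..<N}" "a \<in> {1..N}"
  shows "simple_root X k \<bullet> e N a = (if a = k then 1 else if a = Suc k then -1 else 0)"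
  using assms by (auto simp: differences scalar_prod_linear[of _ N] scalar_prod_e)

lemma simple_reflection_exchange:
  assumes "k \<in> {1..<N}" "a \<in> {1..N}"
  shows "simple_reflection X k (e N a) = e N (if a = k then Suc k else if a = Suc k then k else a)"
proof -
  have "simple_root X k \<bullet> simple_root X k = 2"
    using assms by (simp add: differences scalar_prod_linear[of _ N] scalar_prod_e)
  then have "simple_reflection X k (e N a) =
      e N a - (simple_root X k \<bullet> e N a) \<cdot>\<^sub>v simple_root X k"
    by (simp add: simple_reflection_def root_reflection_apply dim)
  also have "\<dots> = e N a - (if a = k then 1 else if a = Suc k then -1 else 0) \<cdot>\<^sub>v (e N k - e N (Suc k))"
    by (subst scalar_prod_difference[OF assms], subst differences[OF assms(1)], rule refl)
  also have "\<dots> = e N (if a = k then Suc k else if a = Suc k then k else a)"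
    by (rule eq_vecI) auto
  finally show ?thesis .
qed

lemmas exchange_simps = scalar_prod_linear[of _ N] simple_reflection_linear simple_reflection_smult
  rank closed
  scalar_prod_difference simple_reflection_exchange

lemma minus_ascending:
  assumes "1 \<le> i" "i < j" "j \<le> N"
  shows "ascending_palindrome X (asc i (j - 2) @ [j - 1] @ desc (j - 2) i) (e N i - e N j)"
proof (rule ascending_palindrome_climb[where \<beta> = "\<lambda>k. e N k - e N j"])
  have j: "j - 1 \<in> {1..<N}" "j - 1 = Suc (j - 2)" "Suc (j - 1) = j" using assms by auto
  show "ascending_palindrome X [j - 1] (e N (Suc (j - 2)) - e N j)"
    using ascending_palindrome.centre[OF rank[OF j(1)]] differences[OF j(1)] j(2,3) by simp
next
  fix k assume k: "i \<le> k" "k \<le> j - 2"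
  then have "k \<in> {1..<N}" "Suc k < j" using assms by auto
  then show "k \<in> {1..weyl_rank X} \<and> simple_root X k \<bullet> (e N (Suc k) - e N j) < 0 \<and>
      simple_reflection X k (e N (Suc k) - e N j) = e N k - e N j"
    using assms rank[of k] by (simp add: exchange_simps)
qed (use assms in auto)

lemma plus_ascending:
  assumes "ascending_palindrome X u (e N (N - 1) + e N N)" "1 \<le> i" "i < N"
  shows "ascending_palindrome X (asc i (N - 2) @ u @ desc (N - 2) i) (e N i + e N N)"
proof (rule ascending_palindrome_climb[where \<beta> = "\<lambda>k. e N k + e N N"])
  show "ascending_palindrome X u (e N (Suc (N - 2)) + e N N)"
    using assms by (simp add: Suc_diff_Suc numeral_2_eq_2)
next
  fix k assume k: "i \<le> k" "k \<le> N - 2"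
  then have "k \<in> {1..<N}" "Suc k < N" using assms by auto
  then show "k \<in> {1..weyl_rank X} \<and> simple_root X k \<bullet> (e N (Suc k) + e N N) < 0 \<and>
      simple_reflection X k (e N (Suc k) + e N N) = e N k + e N N"
    using assms rank[of k] by (simp add: exchange_simps)
qed (use assms in auto)

lemma minus_roots_closed:
  assumes "\<beta> \<in> minus_roots N" "k \<in> {1..<N}" "simple_root X k \<bullet> \<beta> < 0"
  shows "simple_reflection X k \<beta> \<in> minus_roots N"
proof -
  obtain i j where ij: "1 \<le> i" "i < j" "j \<le> N" "\<beta> = e N i - e N j"
    using assms(1) by (auto simp: minus_roots_def)
  define \<sigma> where "\<sigma> = (\<lambda>a. if a = k then Suc k else if a = Suc k then k else a)"
  have "simple_reflection X k \<beta> = e N (\<sigma> i) - e N (\<sigma> j)"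
    using ij assms(2) rank[OF assms(2)] by (simp add: exchange_simps \<sigma>_def)
  \<comment> \<open>The exchange keeps the order of every pair \<open>i < j\<close> except \<open>k, k + 1\<close>, which belongs to
    \<open>\<alpha>\<^sub>k\<close> itself and has a positive product with it.\<close>
  moreover have "\<not> (i = k \<and> j = Suc k)"
    using ij assms(2,3) rank[OF assms(2)] by (auto simp: exchange_simps)
  then have "1 \<le> \<sigma> i" "\<sigma> i < \<sigma> j" "\<sigma> j \<le> N"
    using ij assms(2) by (auto simp: \<sigma>_def)
  ultimately show ?thesis unfolding minus_roots_def by blast
qed

lemma plus_roots_closed:
  assumes "\<beta> \<in> plus_roots N" "k \<in> {1..<N}" "simple_root X k \<bullet> \<beta> < 0"
  shows "simple_reflection X k \<beta> \<in> plus_roots N"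
proof -
  obtain i j where ij: "1 \<le> i" "i < j" "j \<le> N" "\<beta> = e N i + e N j"
    using assms(1) by (auto simp: plus_roots_def)
  define \<sigma> where "\<sigma> = (\<lambda>a. if a = k then Suc k else if a = Suc k then k else a)"
  have "simple_reflection X k \<beta> = e N (\<sigma> i) + e N (\<sigma> j)"
    using ij assms(2) rank[OF assms(2)] by (simp add: exchange_simps \<sigma>_def)
  \<comment> \<open>Here the exceptional root \<open>e\<^sub>k + e\<^sub>k\<^sub>+\<^sub>1\<close> is orthogonal to \<open>\<alpha>\<^sub>k\<close>.\<close>
  moreover have "\<not> (i = k \<and> j = Suc k)"
    using ij assms(2,3) rank[OF assms(2)] by (auto simp: exchange_simps)
  then have "1 \<le> \<sigma> i" "\<sigma> i < \<sigma> j" "\<sigma> j \<le> N"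
    using ij assms(2) by (auto simp: \<sigma>_def)
  ultimately show ?thesis unfolding plus_roots_def by blast
qed

lemma list_minus_ascending:
  "(\<alpha>, u) \<in> set (list_minus N) \<Longrightarrow> ascending_palindrome X u \<alpha>"
  using minus_ascending by (fastforce simp: list_minus_def)

lemma simple_root_minus: "k \<in> {1..<N} \<Longrightarrow> simple_root X k \<in> minus_roots N"
  unfolding minus_roots_def differences by (intro CollectI exI[of _ k] exI[of _ "Suc k"]) auto

end


section \<open>Type A\<close>

lemma coordinate_type_A: "coordinate_type (Type_A n) (n + 1)"
  by standard auto

lemma fst_list_A: "fst ` set (list_A n) = minus_roots (n + 1)"
proof
  show "fst ` set (list_A n) \<subseteq> minus_roots (n + 1)"
    by (force simp: list_A_def minus_roots_def)
  show "minus_roots (n + 1) \<subseteq> fst ` set (list_A n)"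
  proof
    fix \<beta> assume "\<beta> \<in> minus_roots (n + 1)"
    then obtain i j where ij: "1 \<le> i" "i < j" "j \<le> n + 1" "\<beta> = e (n + 1) i - e (n + 1) j"
      by (auto simp: minus_roots_def)
    define j' where "j' = j - 1"
    have "i \<le> j'" "j' \<le> n" "\<beta> = e (n + 1) i - e (n + 1) (j' + 1)"
      using ij by (auto simp: j'_def)
    then show "\<beta> \<in> fst ` set (list_A n)" using \<open>1 \<le> i\<close> by (force simp: list_A_def simp del: upt_Suc)
  qed
qed

lemma type_A:
  assumes "simple_system (Type_A n) \<Phi>"
  shows "(\<forall>(\<alpha>, u) \<in> set (list_A n).
            word_prod (Type_A n) u = root_reflection (Type_A n) \<alpha> \<and> palindromic u \<and>
            reduced_expression (Type_A n) u (root_reflection (Type_A n) \<alpha>)) \<and>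
         (distinct (map fst (list_A n)) \<and>
          set (map fst (list_A n)) = positive_roots (Type_A n) \<Phi>) \<and>
         (distinct (map (\<lambda>(\<alpha>, u). root_reflection (Type_A n) \<alpha>) (list_A n)) \<and>
          set (map (\<lambda>(\<alpha>, u). root_reflection (Type_A n) \<alpha>) (list_A n)) = reflections (Type_A n))"
proof -
  interpret simple_system "Type_A n" \<Phi> by (rule assms)
  interpret coordinate_type "Type_A n" "n + 1" by (rule coordinate_type_A)
  show ?thesis
  proof (rule reflection_list_criterion)
    \<comment> \<open>The entry with parameters \<open>i, j\<close> belongs to \<open>e\<^sub>i - e\<^sub>j\<^sub>+\<^sub>1\<close>, hence the shift of \<open>j\<close>.\<close>
    fix \<alpha> u assume "(\<alpha>, u) \<in> set (list_A n)"
    then obtain i j where ij: "1 \<le> i" "i \<le> j" "j \<le> n" "\<alpha> = e (n + 1) i - e (n + 1) (j + 1)"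
      "u = asc i (j - 1) @ [j] @ desc (j - 1) i"
      by (auto simp: list_A_def)
    then show "ascending_palindrome (Type_A n) u \<alpha>"
      using minus_ascending[of i "j + 1"] by simp
  next
    have "map fst (list_A n) =
        concat (map (\<lambda>i. map (\<lambda>j. e (n + 1) i - e (n + 1) (j + 1)) [i..<n + 1]) [1..<n + 1])"
      by (simp add: list_A_def map_concat comp_def)
    also have "distinct \<dots>"
    proof (rule distinct_double_comprehension)
      fix i j i' j'
      assume "i \<in> set [1..<n + 1]" "j \<in> set [i..<n + 1]" "i' \<in> set [1..<n + 1]" "j' \<in> set [i'..<n + 1]"
        "e (n + 1) i - e (n + 1) (j + 1) = e (n + 1) i' - e (n + 1) (j' + 1)"
      then show "i = i' \<and> j = j'"
        using e_minus_inj[of i "n + 1" "j + 1" i' "j' + 1"] by (simp del: upt_Suc)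
    qed auto
    finally show "distinct (map fst (list_A n))" .
  qed (use simple_root_minus minus_roots_closed in \<open>auto simp only: fst_list_A weyl_rank.simps
      atLeastLessThanSuc_atLeastAtMost Suc_eq_plus1[symmetric]\<close>)
qed


section \<open>Types B and C\<close>

text \<open>The last simple root is a positive multiple of \<open>e\<^sub>n\<close>, by 1 in type B and by 2 in type C.
  Its length does not affect the reflection, which changes the sign of the last coordinate.\<close>

locale coordinate_type_BC = coordinate_type X n for X n +
  fixes c :: real
  assumes n: "n \<ge> 2" and rank_eq: "weyl_rank X = n"
    and last: "simple_root X n = c \<cdot>\<^sub>v e n n" and c: "c > 0"
begin

definition list_BC :: "(real vec \<times> nat list) list" where
  "list_BC = list_minus n @ list_plus_BC n @
     [(c \<cdot>\<^sub>v e n i, asc i (n - 1) @ [n] @ desc (n - 1) i). i \<leftarrow> [1..<n + 1]]"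

lemma n_index: "n \<in> {1..weyl_rank X}"
  using n rank_eq by simp

lemma scalar_prod_last: "a \<in> {1..n} \<Longrightarrow> simple_root X n \<bullet> e n a = (if a = n then c else 0)"
  using n by (auto simp: last scalar_prod_linear[of _ n] scalar_prod_e)

lemma simple_reflection_sign_change:
  assumes "a \<in> {1..n}"
  shows "simple_reflection X n (e n a) = (if a = n then - e n n else e n a)"
proof -
  have "simple_root X n \<bullet> simple_root X n = c * c"
    using n by (simp add: last scalar_prod_linear[of _ n] scalar_prod_e)
  then have "simple_reflection X n (e n a) =
      e n a - (2 * (simple_root X n \<bullet> e n a) / (c * c)) \<cdot>\<^sub>v simple_root X n"
    by (simp add: simple_reflection_def root_reflection_apply dim)
  also have "\<dots> = e n a - (2 * (if a = n then c else 0) / (c * c)) \<cdot>\<^sub>v (c \<cdot>\<^sub>v e n n)"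
    by (subst scalar_prod_last[OF assms], subst last, rule refl)
  also have "\<dots> = (if a = n then - e n n else e n a)"
    by (rule eq_vecI) (use c in auto)
  finally show ?thesis .
qed

lemmas sign_simps = scalar_prod_linear[of _ n] simple_reflection_linear simple_reflection_smult
  closed n_index[simplified]
  scalar_prod_last simple_reflection_sign_change

lemma list_BC_ascending:
  assumes "(\<alpha>, u) \<in> set list_BC"
  shows "ascending_palindrome X u \<alpha>"
proof -
  from assms have "(\<alpha>, u) \<in> set (list_minus n) \<or>
      (\<exists>i j. 1 \<le> i \<and> i < j \<and> j \<le> n \<and> \<alpha> = e n i + e n j \<and>
        u = asc j (n - 1) @ (asc i (n - 2) @ [n, n - 1, n] @ desc (n - 2) i) @ desc (n - 1) j) \<or>
      (\<exists>i. 1 \<le> i \<and> i \<le> n \<and> \<alpha> = c \<cdot>\<^sub>v e n i \<and> u = asc i (n - 1) @ [n] @ desc (n - 1) i)"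
    unfolding list_BC_def set_append Un_iff
  proof (elim disjE, goal_cases)
    case 2
    then obtain i j where ij: "i \<in> set [1..<n + 1]" "j \<in> set [i + 1..<n + 1]"
      "(\<alpha>, u) = (e n i + e n j, (asc j (n - 1) @ asc i (n - 2)) @ [n, n - 1, n] @
        (desc (n - 2) i @ desc (n - 1) j))"
      unfolding list_plus_BC_def set_double_comprehension by blast
    then have "1 \<le> i \<and> i < j \<and> j \<le> n \<and> \<alpha> = e n i + e n j \<and>
        u = asc j (n - 1) @ (asc i (n - 2) @ [n, n - 1, n] @ desc (n - 2) i) @ desc (n - 1) j"
      by (simp del: upt_Suc)
    then show ?case by blast
  next
    case 3
    then show ?case by (intro disjI2) (auto simp del: upt_Suc)
  qed blast
  then consider "(\<alpha>, u) \<in> set (list_minus n)"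
    | i j where "1 \<le> i" "i < j" "j \<le> n" "\<alpha> = e n i + e n j"
      "u = asc j (n - 1) @ (asc i (n - 2) @ [n, n - 1, n] @ desc (n - 2) i) @ desc (n - 1) j"
    | i where "1 \<le> i" "i \<le> n" "\<alpha> = c \<cdot>\<^sub>v e n i" "u = asc i (n - 1) @ [n] @ desc (n - 1) i"
    by blast
  then show ?thesis
  proof cases
    case 1
    then show ?thesis by (rule list_minus_ascending)
  next
    case (2 i j)
    have m: "n - 1 \<in> {1..<n}" "Suc (n - 1) = n" "n - 1 \<noteq> n" using n by auto
    \<comment> \<open>The centre \<open>n - 1\<close> starts at \<open>e\<^sub>n\<^sub>-\<^sub>1 - e\<^sub>n\<close>, and the letter \<open>n\<close> flips the sign of \<open>e\<^sub>n\<close>. From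
      \<open>e\<^sub>n\<^sub>-\<^sub>1 + e\<^sub>n\<close> the first index climbs to \<open>i\<close>, then the second one to \<open>j\<close>.\<close>
    have "ascending_palindrome X [n - 1] (e n (n - 1) - e n n)"
      using ascending_palindrome.centre[OF rank[OF m(1)]] differences[OF m(1)] m(2) by simp
    then have "ascending_palindrome X ([n] @ [n - 1] @ [n])
        (simple_reflection X n (e n (n - 1) - e n n))"
      by (rule ascending_palindrome.wrap[OF _ n_index]) (use n c in \<open>simp add: sign_simps\<close>)
    moreover have "simple_reflection X n (e n (n - 1) - e n n) = e n (n - 1) - (- e n n)"
      using n m by (simp add: sign_simps)
    moreover have "e n (n - 1) - (- e n n) = e n (n - 1) + e n n" by auto
    ultimately have "ascending_palindrome X [n, n - 1, n] (e n (n - 1) + e n n)" by simp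
    then have *: "ascending_palindrome X (asc i (n - 2) @ [n, n - 1, n] @ desc (n - 2) i) (e n i + e n n)"
      using 2 by (intro plus_ascending) auto
    show ?thesis unfolding 2(4,5)
    proof (rule ascending_palindrome_climb[where \<beta> = "\<lambda>k. e n i + e n k"])
      show "ascending_palindrome X (asc i (n - 2) @ [n, n - 1, n] @ desc (n - 2) i)
          (e n i + e n (Suc (n - 1)))" using * m by simp
    next
      fix k assume "j \<le> k" "k \<le> n - 1"
      then have "k \<in> {1..<n}" "i < k" using 2 n by auto
      then show "k \<in> {1..weyl_rank X} \<and> simple_root X k \<bullet> (e n i + e n (Suc k)) < 0 \<and>
          simple_reflection X k (e n i + e n (Suc k)) = e n i + e n k"
        using 2 rank[of k] by (simp add: exchange_simps)
    qed (use 2 in auto)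
  next
    case (3 i)
    show ?thesis unfolding 3(3,4)
    proof (rule ascending_palindrome_climb[where \<beta> = "\<lambda>k. c \<cdot>\<^sub>v e n k"])
      show "ascending_palindrome X [n] (c \<cdot>\<^sub>v e n (Suc (n - 1)))"
        using ascending_palindrome.centre[OF n_index] n by (simp add: last)
    next
      fix k assume "i \<le> k" "k \<le> n - 1"
      then have "k \<in> {1..<n}" using 3 n by auto
      then show "k \<in> {1..weyl_rank X} \<and> simple_root X k \<bullet> (c \<cdot>\<^sub>v e n (Suc k)) < 0 \<and>
          simple_reflection X k (c \<cdot>\<^sub>v e n (Suc k)) = c \<cdot>\<^sub>v e n k"
        using 3 c rank[of k] by (simp add: exchange_simps)
    qed (use 3 in auto)
  qed
qed

definition single_roots :: "real vec set" where
  "single_roots = {c \<cdot>\<^sub>v e n i | i. 1 \<le> i \<and> i \<le> n}"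

lemma fst_list_plus_BC: "fst ` set (list_plus_BC n) = plus_roots n"
  by (force simp: list_plus_BC_def plus_roots_def)

lemma fst_list_BC: "fst ` set list_BC = minus_roots n \<union> plus_roots n \<union> single_roots"
proof -
  have "fst ` set list_BC = fst ` set (list_minus n) \<union> fst ` set (list_plus_BC n) \<union>
      (\<lambda>i. c \<cdot>\<^sub>v e n i) ` {1..<n + 1}"
    by (simp add: list_BC_def image_Un image_image Un_assoc del: upt_Suc)
  also have "(\<lambda>i. c \<cdot>\<^sub>v e n i) ` {1..<n + 1} = single_roots"
    by (auto simp: single_roots_def)
  finally show ?thesis by (simp add: fst_list_minus fst_list_plus_BC)
qed

lemma distinct_list_BC: "distinct (map fst list_BC)"
proof -
  have "map fst (list_plus_BC n) =
      concat (map (\<lambda>i. map (\<lambda>j. e n i + e n j) [i + 1..<n + 1]) [1..<n + 1])"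
    by (simp add: list_plus_BC_def map_concat comp_def)
  also have "distinct \<dots>"
  proof (rule distinct_double_comprehension)
    fix i j i' j'
    assume "i \<in> set [1..<n + 1]" "j \<in> set [i + 1..<n + 1]" "i' \<in> set [1..<n + 1]"
      "j' \<in> set [i' + 1..<n + 1]" "e n i + e n j = e n i' + e n j'"
    then show "i = i' \<and> j = j'" using e_plus_inj[of i n j i' j'] by (simp del: upt_Suc)
  qed auto
  finally have plus: "distinct (map fst (list_plus_BC n))" .
  have "inj_on (\<lambda>i. c \<cdot>\<^sub>v e n i) {1..n}"
    by (rule inj_onI) (rule e_smult_inj[OF _ _ _ c])
  moreover have "set [1..<n + 1] = {1..n}" by auto
  ultimately have single: "distinct (map (\<lambda>i. c \<cdot>\<^sub>v e n i) [1..<n + 1])"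
    by (simp only: distinct_map distinct_upt simp_thms)
  have "minus_roots n \<inter> single_roots = {}"
    using e_smult_neq_minus[OF _ _ _ _ c]
    by (fastforce simp: minus_roots_def single_roots_def)
  then have "minus_roots n \<inter> (plus_roots n \<union> single_roots) = {}"
    using minus_roots_disjoint_plus_roots by blast
  moreover have "plus_roots n \<inter> single_roots = {}"
    using e_smult_neq_plus by (fastforce simp: plus_roots_def single_roots_def)
  moreover have "set (map (\<lambda>i. c \<cdot>\<^sub>v e n i) [1..<n + 1]) = single_roots"
    by (auto simp: single_roots_def)
  moreover have "map fst list_BC = map fst (list_minus n) @ map fst (list_plus_BC n) @
      map (\<lambda>i. c \<cdot>\<^sub>v e n i) [1..<n + 1]"
    by (simp add: list_BC_def comp_def)
  ultimately show ?thesis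
    using distinct_list_minus plus single fst_list_minus[of n] fst_list_plus_BC
    by (simp only: distinct_append set_append set_map)
qed

lemma list_BC_closed:
  assumes "\<beta> \<in> minus_roots n \<union> plus_roots n \<union> single_roots" "k \<in> {1..n}" "simple_root X k \<bullet> \<beta> < 0"
  shows "simple_reflection X k \<beta> \<in> minus_roots n \<union> plus_roots n \<union> single_roots"
proof (cases "k = n")
  case False
  then have k: "k \<in> {1..<n}" using assms by auto
  show ?thesis
  proof (cases "\<beta> \<in> single_roots")
    case True
    then obtain i where i: "1 \<le> i" "i \<le> n" "\<beta> = c \<cdot>\<^sub>v e n i" by (auto simp: single_roots_def)
    then have "simple_reflection X k \<beta> = c \<cdot>\<^sub>v e n (if i = k then Suc k else if i = Suc k then k else i)"
      using k rank[OF k] by (simp add: exchange_simps)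
    then have "simple_reflection X k \<beta> \<in> single_roots"
      using i k unfolding single_roots_def by auto
    then show ?thesis by blast
  qed (use assms minus_roots_closed[OF _ k] plus_roots_closed[OF _ k] in auto)
next
  case True
  \<comment> \<open>Only \<open>e\<^sub>i - e\<^sub>n\<close> makes an obtuse angle with the last simple root.\<close>
  have "\<beta> \<notin> plus_roots n" "\<beta> \<notin> single_roots"
    using assms(3) True c n
    by (auto simp: plus_roots_def single_roots_def sign_simps split: if_splits)
  then obtain i j where ij: "1 \<le> i" "i < j" "j \<le> n" "\<beta> = e n i - e n j"
    using assms(1) by (auto simp: minus_roots_def)
  have "j = n" using assms(3) True ij by (auto simp: sign_simps split: if_splits)
  then have "simple_reflection X k \<beta> = e n i - (- e n n)"
    using ij True by (simp add: sign_simps)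
  also have "\<dots> = e n i + e n n" by auto
  finally show ?thesis using ij \<open>j = n\<close> unfolding plus_roots_def by blast
qed

lemma type_BC:
  assumes "simple_system X \<Phi>"
  shows "(\<forall>(\<alpha>, u) \<in> set list_BC.
            word_prod X u = root_reflection X \<alpha> \<and> palindromic u \<and>
            reduced_expression X u (root_reflection X \<alpha>)) \<and>
         (distinct (map fst list_BC) \<and> set (map fst list_BC) = positive_roots X \<Phi>) \<and>
         (distinct (map (\<lambda>(\<alpha>, u). root_reflection X \<alpha>) list_BC) \<and>
          set (map (\<lambda>(\<alpha>, u). root_reflection X \<alpha>) list_BC) = reflections X)"
proof (rule simple_system.reflection_list_criterion[OF assms])
  fix i assume i: "i \<in> {1..weyl_rank X}"
  show "simple_root X i \<in> fst ` set list_BC"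
  proof (cases "i = n")
    case True
    then show ?thesis using n unfolding fst_list_BC single_roots_def by (auto simp: last)
  qed (use i simple_root_minus[of i] rank_eq in \<open>auto simp: fst_list_BC\<close>)
qed (use list_BC_ascending distinct_list_BC list_BC_closed rank_eq in \<open>auto simp only: fst_list_BC\<close>)

end

lemma coordinate_type_B: "n \<ge> 2 \<Longrightarrow> coordinate_type_BC (Type_B n) n 1"
  by standard auto

lemma coordinate_type_C: "n \<ge> 2 \<Longrightarrow> coordinate_type_BC (Type_C n) n 2"
  by standard auto

lemma list_BC_B: "n \<ge> 2 \<Longrightarrow> coordinate_type_BC.list_BC n 1 = list_B n"
  by (simp add: coordinate_type_BC.list_BC_def[OF coordinate_type_B] list_B_def)

lemma list_BC_C: "n \<ge> 2 \<Longrightarrow> coordinate_type_BC.list_BC n 2 = list_C n"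
  by (simp add: coordinate_type_BC.list_BC_def[OF coordinate_type_C] list_C_def)

section \<open>Type D\<close>

text \<open>Here the last simple reflection exchanges the last two coordinates and changes their signs.\<close>

locale coordinate_type_D = coordinate_type "Type_D n" n for n +
  assumes n: "n \<ge> 4"
begin

abbreviation X :: weyl_type where
  "X \<equiv> Type_D n"

lemma n_index: "n \<in> {1..weyl_rank X}"
  using n by simp

lemma scalar_prod_last:
  "a \<in> {1..n} \<Longrightarrow> simple_root X n \<bullet> e n a = (if a = n \<or> a = n - 1 then 1 else 0)"
  using n by (auto simp: scalar_prod_linear[of _ n] scalar_prod_e)

lemma simple_reflection_signed_exchange:
  assumes "a \<in> {1..n}"
  shows "simple_reflection X n (e n a) =
    (if a = n then - e n (n - 1) else if a = n - 1 then - e n n else e n a)"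
proof -
  have "simple_root X n \<bullet> simple_root X n = 2"
    using n by (simp add: scalar_prod_linear[of _ n] scalar_prod_e)
  then have "simple_reflection X n (e n a) =
      e n a - (simple_root X n \<bullet> e n a) \<cdot>\<^sub>v simple_root X n"
    by (simp add: simple_reflection_def root_reflection_apply del: simple_root.simps)
  also have "\<dots> = e n a - (if a = n \<or> a = n - 1 then 1 else 0) \<cdot>\<^sub>v (e n (n - 1) + e n n)"
    by (subst scalar_prod_last[OF assms]) simp
  also have "\<dots> = (if a = n then - e n (n - 1) else if a = n - 1 then - e n n else e n a)"
    using n by (intro eq_vecI) auto
  finally show ?thesis .
qed

lemmas signed_simps = scalar_prod_linear[of _ n] simple_reflection_linear simple_reflection_smult
  closed n_index[simplified]
  scalar_prod_last simple_reflection_signed_exchange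

declare simple_root.simps [simp del]

lemma list_D_ascending:
  assumes "(\<alpha>, u) \<in> set (list_D n)"
  shows "ascending_palindrome X u \<alpha>"
proof -
  from assms have "(\<alpha>, u) \<in> set (list_minus n) \<or>
      (\<exists>i. 1 \<le> i \<and> i < n \<and> \<alpha> = e n i + e n n \<and> u = asc i (n - 2) @ [n] @ desc (n - 2) i) \<or>
      (\<exists>i j. 1 \<le> i \<and> i < j \<and> j < n \<and> \<alpha> = e n i + e n j \<and>
        u = asc j (n - 2) @ (asc i (n - 3) @ [n - 1, n - 2, n, n - 2, n - 1] @ desc (n - 3) i) @
          desc (n - 2) j)"
    unfolding list_D_def set_append Un_iff
  proof (elim disjE, goal_cases)
    case 2
    then obtain i where "i \<in> set [1..<n]"
      "(\<alpha>, u) = (e n i + e n n, asc i (n - 2) @ [n] @ desc (n - 2) i)"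
      unfolding set_map by blast
    then have "1 \<le> i \<and> i < n \<and> \<alpha> = e n i + e n n \<and> u = asc i (n - 2) @ [n] @ desc (n - 2) i"
      by simp
    then show ?case by blast
  next
    case 3
    then obtain i j where ij: "i \<in> set [1..<n]" "j \<in> set [i + 1..<n]"
      "(\<alpha>, u) = (e n i + e n j, (asc j (n - 2) @ asc i (n - 3)) @
        [n - 1, n - 2, n, n - 2, n - 1] @ (desc (n - 3) i @ desc (n - 2) j))"
      unfolding set_double_comprehension by blast
    then have "1 \<le> i \<and> i < j \<and> j < n \<and> \<alpha> = e n i + e n j \<and>
        u = asc j (n - 2) @ (asc i (n - 3) @ [n - 1, n - 2, n, n - 2, n - 1] @ desc (n - 3) i) @
          desc (n - 2) j"
      by simp
    then show ?case by blast
  qed blast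
  then consider "(\<alpha>, u) \<in> set (list_minus n)"
    | i where "1 \<le> i" "i < n" "\<alpha> = e n i + e n n" "u = asc i (n - 2) @ [n] @ desc (n - 2) i"
    | i j where "1 \<le> i" "i < j" "j < n" "\<alpha> = e n i + e n j"
      "u = asc j (n - 2) @ (asc i (n - 3) @ [n - 1, n - 2, n, n - 2, n - 1] @ desc (n - 3) i) @
        desc (n - 2) j"
    by blast
  moreover have last: "simple_root X n = e n (n - 1) + e n n" by (simp add: simple_root.simps)
  then have start: "ascending_palindrome X [n] (e n (n - 1) + e n n)"
    using ascending_palindrome.centre[OF n_index] by simp
  ultimately show ?thesis
  proof cases
    case 1
    then show ?thesis by (rule list_minus_ascending)
  next
    case (2 i)
    show ?thesis unfolding 2(3,4) using start 2 by (intro plus_ascending) auto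
  next
    case (3 i j)
    have m: "n - 1 \<in> {1..<n}" "Suc (n - 1) = n" "n - 2 \<in> {1..<n}" "Suc (n - 2) = n - 1"
      "Suc (n - 3) = n - 2" "n - 1 \<noteq> n" "n - 2 \<noteq> n" "n - 2 \<noteq> n - 1" using n by auto
    \<comment> \<open>The five central letters move \<open>e\<^sub>n\<^sub>-\<^sub>1 + e\<^sub>n\<close> to \<open>e\<^sub>n\<^sub>-\<^sub>2 + e\<^sub>n\<close> and then to
      \<open>e\<^sub>n\<^sub>-\<^sub>2 + e\<^sub>n\<^sub>-\<^sub>1\<close>. From there the first index climbs to \<open>i\<close>, then the second one to \<open>j\<close>.\<close>
    have "ascending_palindrome X ([n - 2] @ [n] @ [n - 2])
        (simple_reflection X (n - 2) (e n (n - 1) + e n n))"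
      by (rule ascending_palindrome.wrap[OF start rank[OF m(3)]])
         (use n m m(6-8)[symmetric] in \<open>simp add: exchange_simps\<close>)
    moreover have "simple_reflection X (n - 2) (e n (n - 1) + e n n) = e n (n - 2) + e n n"
      using n m m(6-8)[symmetric] by (simp add: exchange_simps)
    ultimately have "ascending_palindrome X [n - 2, n, n - 2] (e n (n - 2) + e n n)" by simp
    then have "ascending_palindrome X ([n - 1] @ [n - 2, n, n - 2] @ [n - 1])
        (simple_reflection X (n - 1) (e n (n - 2) + e n n))"
      by (rule ascending_palindrome.wrap[OF _ rank[OF m(1)]])
         (use n m m(6-8)[symmetric] in \<open>simp add: exchange_simps\<close>)
    moreover have "simple_reflection X (n - 1) (e n (n - 2) + e n n) = e n (n - 2) + e n (n - 1)"
      using n m m(6-8)[symmetric] by (simp add: exchange_simps)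
    ultimately have c: "ascending_palindrome X [n - 1, n - 2, n, n - 2, n - 1]
        (e n (Suc (n - 3)) + e n (n - 1))" using m by simp
    have *: "ascending_palindrome X
        (asc i (n - 3) @ [n - 1, n - 2, n, n - 2, n - 1] @ desc (n - 3) i) (e n i + e n (n - 1))"
    proof (rule ascending_palindrome_climb[where \<beta> = "\<lambda>k. e n k + e n (n - 1)", OF c])
      fix k assume "i \<le> k" "k \<le> n - 3"
      then have "k \<in> {1..<n}" "Suc k < n - 1" using 3 n by auto
      then show "k \<in> {1..weyl_rank X} \<and> simple_root X k \<bullet> (e n (Suc k) + e n (n - 1)) < 0 \<and>
          simple_reflection X k (e n (Suc k) + e n (n - 1)) = e n k + e n (n - 1)"
        using 3 rank[of k] by (simp add: exchange_simps)
    qed (use 3 n in auto)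
    show ?thesis unfolding 3(4,5)
    proof (rule ascending_palindrome_climb[where \<beta> = "\<lambda>k. e n i + e n k"])
      show "ascending_palindrome X
          (asc i (n - 3) @ [n - 1, n - 2, n, n - 2, n - 1] @ desc (n - 3) i)
          (e n i + e n (Suc (n - 2)))" using * m by simp
    next
      fix k assume "j \<le> k" "k \<le> n - 2"
      then have "k \<in> {1..<n}" "i < k" using 3 n by auto
      then show "k \<in> {1..weyl_rank X} \<and> simple_root X k \<bullet> (e n i + e n (Suc k)) < 0 \<and>
          simple_reflection X k (e n i + e n (Suc k)) = e n i + e n k"
        using 3 rank[of k] by (simp add: exchange_simps)
    qed (use 3 in auto)
  qed
qed

lemma map_fst_list_D:
  "map fst (list_D n) = map fst (list_minus n) @ map (\<lambda>i. e n i + e n n) [1..<n] @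
    concat (map (\<lambda>i. map (\<lambda>j. e n i + e n j) [i + 1..<n]) [1..<n])"
  by (simp add: list_D_def map_concat comp_def)

lemma plus_roots_split:
  "set (map (\<lambda>i. e n i + e n n) [1..<n]) \<union>
    set (concat (map (\<lambda>i. map (\<lambda>j. e n i + e n j) [i + 1..<n]) [1..<n])) = plus_roots n"
  unfolding set_double_comprehension
proof
  show "plus_roots n \<subseteq> set (map (\<lambda>i. e n i + e n n) [1..<n]) \<union>
      {e n i + e n j | i j. i \<in> set [1..<n] \<and> j \<in> set [i + 1..<n]}"
  proof
    fix \<beta> assume "\<beta> \<in> plus_roots n"
    then obtain i j where "1 \<le> i" "i < j" "j \<le> n" "\<beta> = e n i + e n j"
      by (auto simp: plus_roots_def)
    then show "\<beta> \<in> set (map (\<lambda>i. e n i + e n n) [1..<n]) \<union>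
        {e n i + e n j | i j. i \<in> set [1..<n] \<and> j \<in> set [i + 1..<n]}"
      by (cases "j = n") force+
  qed
qed (auto intro: plus_rootsI)

lemma fst_list_D: "fst ` set (list_D n) = minus_roots n \<union> plus_roots n"
proof -
  have "fst ` set (list_D n) = set (map fst (list_D n))" by simp
  also have "\<dots> = minus_roots n \<union> plus_roots n"
    by (simp only: map_fst_list_D set_append set_map[of fst] fst_list_minus plus_roots_split)
  finally show ?thesis .
qed

lemma distinct_list_D: "distinct (map fst (list_D n))"
proof -
  have inj: "i = i' \<and> j = j'"
    if "e n i + e n j = e n i' + e n j'" "1 \<le> i" "i < j" "j \<le> n" "1 \<le> i'" "i' < j'" "j' \<le> n" for i j i' j'
    using e_plus_inj[of i n j i' j'] that by simp
  have inner: "distinct (concat (map (\<lambda>i. map (\<lambda>j. e n i + e n j) [i + 1..<n]) [1..<n]))"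
  proof (rule distinct_double_comprehension)
    fix i j i' j'
    assume "i \<in> set [1..<n]" "j \<in> set [i + 1..<n]" "i' \<in> set [1..<n]"
      "j' \<in> set [i' + 1..<n]" "e n i + e n j = e n i' + e n j'"
    then show "i = i' \<and> j = j'" using inj[of i j i' j'] by simp
  qed auto
  have outer: "distinct (map (\<lambda>i. e n i + e n n) [1..<n])"
    unfolding distinct_map inj_on_def using inj[of _ n _ n] by auto
  have "set (map (\<lambda>i. e n i + e n n) [1..<n]) \<inter>
      set (concat (map (\<lambda>i. map (\<lambda>j. e n i + e n j) [i + 1..<n]) [1..<n])) = {}"
    using inj[of _ n] by fastforce
  moreover have "set (map fst (list_minus n)) \<inter> plus_roots n = {}"
    using minus_roots_disjoint_plus_roots by (simp add: fst_list_minus)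
  ultimately show ?thesis
    using distinct_list_minus inner outer
    by (simp only: map_fst_list_D distinct_append set_append plus_roots_split simp_thms)
qed

lemma list_D_closed:
  assumes "\<beta> \<in> minus_roots n \<union> plus_roots n" "k \<in> {1..n}" "simple_root X k \<bullet> \<beta> < 0"
  shows "simple_reflection X k \<beta> \<in> minus_roots n \<union> plus_roots n"
proof (cases "k = n")
  case False
  then have k: "k \<in> {1..<n}" using assms by auto
  then show ?thesis using assms minus_roots_closed[OF _ k] plus_roots_closed[OF _ k] by auto
next
  case True
  \<comment> \<open>Only \<open>e\<^sub>i - e\<^sub>n\<^sub>-\<^sub>1\<close> and \<open>e\<^sub>i - e\<^sub>n\<close> with \<open>i < n - 1\<close> make an obtuse angle with \<open>\<alpha>\<^sub>n\<close>.\<close>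
  have "\<beta> \<notin> plus_roots n"
    using assms(3) True n by (auto simp: plus_roots_def signed_simps split: if_splits)
  then obtain i j where ij: "1 \<le> i" "i < j" "j \<le> n" "\<beta> = e n i - e n j"
    using assms(1) by (auto simp: minus_roots_def)
  have "i < n - 1 \<and> (j = n \<or> j = n - 1)"
    using assms(3) True ij n by (auto simp: signed_simps split: if_splits)
  then have i: "i < n - 1" and "j = n \<or> j = n - 1" by auto
  from this(2) show ?thesis
  proof
    assume "j = n"
    then have "simple_reflection X k \<beta> = e n i - (- e n (n - 1))"
      using ij i True by (simp add: signed_simps)
    also have "\<dots> = e n i + e n (n - 1)" by auto
    finally show ?thesis using ij(1) i plus_rootsI[of i "n - 1" n] by simp
  next
    assume "j = n - 1"
    then have "simple_reflection X k \<beta> = e n i - (- e n n)"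
      using ij i True n less_imp_neq[of i n] by (auto simp: signed_simps)
    also have "\<dots> = e n i + e n n" by auto
    finally show ?thesis using ij(1) i plus_rootsI[of i n n] by simp
  qed
qed

lemma type_D:
  assumes "simple_system X \<Phi>"
  shows "(\<forall>(\<alpha>, u) \<in> set (list_D n).
            word_prod X u = root_reflection X \<alpha> \<and> palindromic u \<and>
            reduced_expression X u (root_reflection X \<alpha>)) \<and>
         (distinct (map fst (list_D n)) \<and> set (map fst (list_D n)) = positive_roots X \<Phi>) \<and>
         (distinct (map (\<lambda>(\<alpha>, u). root_reflection X \<alpha>) (list_D n)) \<and>
          set (map (\<lambda>(\<alpha>, u). root_reflection X \<alpha>) (list_D n)) = reflections X)"
proof (rule simple_system.reflection_list_criterion[OF assms])
  fix i assume i: "i \<in> {1..weyl_rank X}"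
  show "simple_root X i \<in> fst ` set (list_D n)"
  proof (cases "i = n")
    case True
    have "e n (n - 1) + e n n \<in> plus_roots n"
      using n by (intro plus_rootsI) auto
    then show ?thesis using True unfolding fst_list_D by (simp add: simple_root.simps)
  qed (use i simple_root_minus[of i] in \<open>auto simp: fst_list_D\<close>)
qed (use list_D_ascending distinct_list_D list_D_closed in \<open>auto simp only: fst_list_D weyl_rank.simps\<close>)

end

lemma coordinate_type_D: "n \<ge> 4 \<Longrightarrow> coordinate_type_D n"
  by unfold_locales auto

section \<open>The exceptional types in simple-root coordinates\<close>

text \<open>Row \<open>i\<close> of the matrix \<open>C\<close> lists the Cartan integers
  \<open>2 (\<alpha>\<^sub>i, \<alpha>\<^sub>j) / (\<alpha>\<^sub>i, \<alpha>\<^sub>i)\<close>. The zip in the pairing truncates the row to the length of the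
  coefficient list, so that the matrix of E8 serves E6 and E7 as well.\<close>

definition cartan_pairing :: "int list list \<Rightarrow> nat \<Rightarrow> int list \<Rightarrow> int" where
  "cartan_pairing C i c = sum_list (map2 (*) (C ! (i - 1)) c)"

text \<open>\<open>climbs_to C v c t\<close> applies the letters of \<open>v\<close> from left to right, so \<open>v\<close> is the right half
  of a palindrome, read from the centre outwards.\<close>

fun climbs_to :: "int list list \<Rightarrow> nat list \<Rightarrow> int list \<Rightarrow> int list \<Rightarrow> bool" where
  "climbs_to C [] c t = (c = t)"
| "climbs_to C (i # v) c t =
     (let p = cartan_pairing C i c in
      if p < 0 then climbs_to C v (c[i - 1 := c ! (i - 1) - p]) t else False)"

definition unit_list :: "nat \<Rightarrow> nat \<Rightarrow> int list" where
  "unit_list n k = map (\<lambda>j. if j = k then 1 else 0) [1..<n + 1]"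

definition climbing_entry :: "int list list \<Rightarrow> nat \<Rightarrow> coeff_entry \<Rightarrow> bool" where
  "climbing_entry C n = (\<lambda>(c, u).
     let h = length u div 2; v = drop (Suc h) u; k = u ! h in
     length c = n \<and> u = rev v @ k # v \<and> list_all (\<lambda>i. 1 \<le> i \<and> i \<le> n) u \<and>
     climbs_to C v (unit_list n k) (map int c))"

definition coeffs :: "coeff_entry list \<Rightarrow> int list list" where
  "coeffs L = map (\<lambda>(c, u). map int c) L"

definition upward_neighbours :: "int list list \<Rightarrow> nat \<Rightarrow> int list list \<Rightarrow> int list list" where
  "upward_neighbours C n R =
     concat (map (\<lambda>c. concat (map (\<lambda>i.
       let p = cartan_pairing C i c in
       if p < 0 then [c[i - 1 := c ! (i - 1) - p]] else []) [1..<n + 1])) R)"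

text \<open>The conditions of \<open>reflection_list_criterion\<close> on a coefficient list, apart from upward
  closure, in executable form.\<close>

definition complete_coeff_list :: "int list list \<Rightarrow> nat \<Rightarrow> coeff_entry list \<Rightarrow> bool" where
  "complete_coeff_list C n L \<longleftrightarrow>
     list_all (climbing_entry C n) L \<and> distinct (map fst L) \<and>
     list_all (\<lambda>i. unit_list n i \<in> set (coeffs L)) [1..<n + 1]"

lemma upward_neighboursI:
  assumes "c \<in> set R" "i \<in> {1..n}" "cartan_pairing C i c < 0"
  shows "c[i - 1 := c ! (i - 1) - cartan_pairing C i c] \<in> set (upward_neighbours C n R)"
proof -
  have "i \<in> set [1..<n + 1]" using assms(2) by auto
  then show ?thesis using assms(1,3) unfolding upward_neighbours_def Let_def set_concat set_map by fastforce
qed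

locale cartan_type =
  fixes X :: weyl_type and C :: "int list list"
  assumes simple_closed: "i \<in> {1..weyl_rank X} \<Longrightarrow> simple_root X i \<in> euclid X"
    and simple_norm: "i \<in> {1..weyl_rank X} \<Longrightarrow> simple_root X i \<bullet> simple_root X i > 0"
    and cartan: "i \<in> {1..weyl_rank X} \<Longrightarrow> j \<in> {1..weyl_rank X} \<Longrightarrow>
      2 * (simple_root X i \<bullet> simple_root X j) =
        of_int (C ! (i - 1) ! (j - 1)) * (simple_root X i \<bullet> simple_root X i)"
    and row_length: "i \<in> {1..weyl_rank X} \<Longrightarrow> weyl_rank X \<le> length (C ! (i - 1))"
begin

definition comb :: "int list \<Rightarrow> real vec" where
  "comb c = root_comb X (\<lambda>k. of_int (c ! (k - 1)))"

lemma simple_roots_closed: "simple_root X ` {1..weyl_rank X} \<subseteq> euclid X"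
  using simple_closed by blast

lemma scalar_prod_comb:
  assumes i: "i \<in> {1..weyl_rank X}" and c: "length c = weyl_rank X"
  shows "2 * (simple_root X i \<bullet> comb c) =
    of_int (cartan_pairing C i c) * (simple_root X i \<bullet> simple_root X i)"
proof -
  let ?r = "C ! (i - 1)" and ?s = "simple_root X i \<bullet> simple_root X i"
  have "2 * (simple_root X i \<bullet> comb c) =
      (\<Sum>k\<in>{1..weyl_rank X}. of_int (c ! (k - 1)) * (2 * (simple_root X i \<bullet> simple_root X k)))"
    unfolding comb_def scalar_prod_root_comb[OF simple_roots_closed simple_closed[OF i]]
    by (simp add: sum_distrib_left algebra_simps)
  also have "\<dots> = (\<Sum>k\<in>{1..weyl_rank X}. of_int (?r ! (k - 1) * c ! (k - 1)) * ?s)"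
    by (rule sum.cong) (simp_all only: cartan[OF i] of_int_mult ac_simps)
  also have "\<dots> = (\<Sum>k<weyl_rank X. of_int (?r ! k * c ! k) * ?s)"
    by (rule sum.reindex_bij_witness[of _ Suc "\<lambda>k. k - 1"]) auto
  also have "\<dots> = of_int (\<Sum>k<weyl_rank X. ?r ! k * c ! k) * ?s"
    by (simp add: sum_distrib_right)
  also have "(\<Sum>k<weyl_rank X. ?r ! k * c ! k) = cartan_pairing C i c"
    using row_length[OF i] c
    by (simp add: cartan_pairing_def sum_list_sum_nth atLeast0LessThan min_def)
  finally show ?thesis .
qed

lemma negative_product_iff:
  assumes "i \<in> {1..weyl_rank X}" "length c = weyl_rank X"
  shows "simple_root X i \<bullet> comb c < 0 \<longleftrightarrow> cartan_pairing C i c < 0"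
proof -
  have "simple_root X i \<bullet> comb c < 0 \<longleftrightarrow> 2 * (simple_root X i \<bullet> comb c) < 0" by simp
  also have "\<dots> \<longleftrightarrow> cartan_pairing C i c < 0"
    unfolding scalar_prod_comb[OF assms] using simple_norm[OF assms(1)] by (simp add: mult_less_0_iff)
  finally show ?thesis .
qed

lemma simple_reflection_comb:
  assumes i: "i \<in> {1..weyl_rank X}" and c: "length c = weyl_rank X"
  shows "simple_reflection X i (comb c) = comb (c[i - 1 := c ! (i - 1) - cartan_pairing C i c])"
proof -
  have p: "2 * (simple_root X i \<bullet> comb c) / (simple_root X i \<bullet> simple_root X i) =
      of_int (cartan_pairing C i c)"
    using scalar_prod_comb[OF assms] simple_norm[OF i] by simp
  have "simple_reflection X i (comb c) = root_comb X ((\<lambda>k. of_int (c ! (k - 1)))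
      (i := of_int (c ! (i - 1)) - of_int (cartan_pairing C i c)))"
    unfolding simple_reflection_def p[symmetric] comb_def
    by (rule root_reflection_simple_root_comb[OF simple_roots_closed i])
  also have "\<dots> = comb (c[i - 1 := c ! (i - 1) - cartan_pairing C i c])"
    unfolding comb_def
  proof (rule root_comb_cong[OF _ simple_roots_closed])
    fix k assume k: "k \<in> {1..weyl_rank X}"
    have "i - 1 = k - 1 \<longleftrightarrow> i = k" using i k by auto
    then show "((\<lambda>k. real_of_int (c ! (k - 1)))
        (i := of_int (c ! (i - 1)) - of_int (cartan_pairing C i c))) k =
        of_int (c[i - 1 := c ! (i - 1) - cartan_pairing C i c] ! (k - 1))"
      using i k c by (auto simp: nth_list_update)
  qed
  finally show ?thesis .
qed

lemma comb_unit_list: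
  assumes i: "i \<in> {1..weyl_rank X}" shows "comb (unit_list (weyl_rank X) i) = simple_root X i"
proof -
  have "comb (unit_list (weyl_rank X) i) = root_comb X (\<lambda>k. if k = i then 1 else 0)"
    unfolding comb_def by (rule root_comb_cong[OF _ simple_roots_closed])
      (auto simp: unit_list_def nth_append simp del: upt_Suc)
  then show ?thesis using root_comb_single[OF simple_roots_closed i] by simp
qed

lemma climbs_to_ascending:
  assumes "climbs_to C v c t" "ascending_palindrome X u (comb c)" "length c = weyl_rank X"
    "list_all (\<lambda>i. 1 \<le> i \<and> i \<le> weyl_rank X) v"
  shows "ascending_palindrome X (rev v @ u @ v) (comb t)"
  using assms
proof (induction v arbitrary: u c)
  case (Cons i v)
  then have i: "i \<in> {1..weyl_rank X}" by simp
  have "cartan_pairing C i c < 0" using Cons.prems(1) by (simp add: Let_def split: if_splits)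
  then have "ascending_palindrome X ([i] @ u @ [i]) (simple_reflection X i (comb c))"
    using Cons.prems i by (intro ascending_palindrome.wrap) (simp_all add: negative_product_iff)
  moreover have "climbs_to C v (c[i - 1 := c ! (i - 1) - cartan_pairing C i c]) t"
    using Cons.prems(1) by (simp add: Let_def split: if_splits)
  ultimately have "ascending_palindrome X (rev v @ ([i] @ u @ [i]) @ v) (comb t)"
    using Cons.prems(3,4)
      Cons.IH[of "c[i - 1 := c ! (i - 1) - cartan_pairing C i c]" "[i] @ u @ [i]"]
    by (simp add: simple_reflection_comb[OF i])
  then show ?case by simp
qed simp

lemma entry_comb:
  "root_comb X (\<lambda>k. of_nat (c ! (k - 1))) = comb (map int c)" if "length c = weyl_rank X"
  unfolding comb_def by (rule root_comb_cong[OF _ simple_roots_closed]) (use that in auto)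

lemma complete_coeff_list_criterion:
  assumes sys: "simple_system X \<Phi>" and L: "complete_coeff_list C (weyl_rank X) L"
    and up: "set (upward_neighbours C (weyl_rank X) (coeffs L)) \<subseteq> set (coeffs L)"
  shows "(\<forall>(\<alpha>, u) \<in> set (entries_of_coeffs X L).
            word_prod X u = root_reflection X \<alpha> \<and> palindromic u \<and>
            reduced_expression X u (root_reflection X \<alpha>)) \<and>
         (distinct (map fst (entries_of_coeffs X L)) \<and>
          set (map fst (entries_of_coeffs X L)) = positive_roots X \<Phi>) \<and>
         (distinct (map (\<lambda>(\<alpha>, u). root_reflection X \<alpha>) (entries_of_coeffs X L)) \<and>
          set (map (\<lambda>(\<alpha>, u). root_reflection X \<alpha>) (entries_of_coeffs X L)) = reflections X)"
proof (rule simple_system.reflection_list_criterion[OF sys])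
  interpret simple_system X \<Phi> by (rule sys)
  let ?n = "weyl_rank X" and ?R = "coeffs L"
  have entry: "climbing_entry C ?n (c, u)" if "(c, u) \<in> set L" for c u
    using L that by (auto simp: complete_coeff_list_def list_all_iff)
  have len: "length c = ?n" if "(c, u) \<in> set L" for c u
    using entry[OF that] by (simp add: climbing_entry_def Let_def)
  have fst_eq: "map fst (entries_of_coeffs X L) =
      map (\<lambda>c. root_comb X (\<lambda>k. of_nat (c ! (k - 1)))) (map fst L)"
    by (simp add: entries_of_coeffs_def case_prod_unfold)
  have R: "fst ` set (entries_of_coeffs X L) = comb ` set ?R"
  proof -
    have "fst ` set (entries_of_coeffs X L) = set (map fst (entries_of_coeffs X L))" by simp
    also have "\<dots> = (\<lambda>c. root_comb X (\<lambda>k. of_nat (c ! (k - 1)))) ` fst ` set L"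
      by (simp only: fst_eq set_map)
    also have "\<dots> = (\<lambda>c. comb (map int c)) ` fst ` set L"
      by (rule image_cong) (use len entry_comb in auto)
    also have "\<dots> = comb ` set ?R" by (simp add: coeffs_def image_image case_prod_unfold)
    finally show ?thesis .
  qed
  have lenR: "length c = ?n" if "c \<in> set ?R" for c
    using that len by (auto simp: coeffs_def)
  {
    fix \<alpha> u assume "(\<alpha>, u) \<in> set (entries_of_coeffs X L)"
    then obtain c where c: "(c, u) \<in> set L" "\<alpha> = root_comb X (\<lambda>k. of_nat (c ! (k - 1)))"
      by (auto simp: entries_of_coeffs_def)
    define h where "h = length u div 2"
    define v where "v = drop (Suc h) u"
    have u: "u = rev v @ (u ! h) # v" "list_all (\<lambda>i. 1 \<le> i \<and> i \<le> ?n) u"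
      "climbs_to C v (unit_list ?n (u ! h)) (map int c)"
      using entry[OF c(1)] by (simp_all add: climbing_entry_def Let_def flip: h_def v_def)
    have "u ! h \<in> set u" using u(1) by (metis in_set_conv_decomp)
    then have k: "u ! h \<in> {1..?n}" using u(2) by (auto simp: list_all_iff)
    have "list_all (\<lambda>i. 1 \<le> i \<and> i \<le> ?n) v" using u(2) by (auto simp: v_def list_all_iff dest: in_set_dropD)
    then have "ascending_palindrome X (rev v @ [u ! h] @ v) (comb (map int c))"
      using ascending_palindrome.centre[OF k]
      by (intro climbs_to_ascending[OF u(3)]) (simp_all add: comb_unit_list[OF k], simp add: unit_list_def)
    then show "ascending_palindrome X u \<alpha>" using u(1) c(2) entry_comb[OF len[OF c(1)]] by simp
  next
    have "inj_on (\<lambda>c. root_comb X (\<lambda>k. of_nat (c ! (k - 1)))) (set (map fst L))"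
    proof (rule inj_onI)
      fix c d :: "nat list"
      assume c: "c \<in> set (map fst L)" and d: "d \<in> set (map fst L)"
        and eq: "root_comb X (\<lambda>k. of_nat (c ! (k - 1))) = root_comb X (\<lambda>k. of_nat (d ! (k - 1)))"
      have l: "length c = ?n" "length d = ?n" using c d len by auto
      show "c = d"
      proof (rule nth_equalityI)
        fix i assume "i < length c"
        then show "c ! i = d ! i"
          using root_comb_inj[OF eq, of "Suc i"] l by simp
      qed (use l in simp)
    qed
    then show "distinct (map fst (entries_of_coeffs X L))"
      unfolding fst_eq using L unfolding complete_coeff_list_def distinct_map[of _ "map fst L"] by blast
  next
    fix i assume i: "i \<in> {1..?n}"
    then have "unit_list ?n i \<in> set ?R"
      using L by (auto simp: complete_coeff_list_def list_all_iff simp del: upt_Suc)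
    then show "simple_root X i \<in> fst ` set (entries_of_coeffs X L)"
      unfolding R comb_unit_list[OF i, symmetric] by blast
  next
    fix \<beta> i
    assume \<beta>: "\<beta> \<in> fst ` set (entries_of_coeffs X L)" and i: "i \<in> {1..?n}"
      and neg: "simple_root X i \<bullet> \<beta> < 0"
    obtain c where c: "c \<in> set ?R" "\<beta> = comb c" using \<beta> unfolding R by blast
    have p: "cartan_pairing C i c < 0" using neg negative_product_iff[OF i lenR[OF c(1)]] c(2) by simp
    have "c[i - 1 := c ! (i - 1) - cartan_pairing C i c] \<in> set ?R"
      using upward_neighboursI[OF c(1) i p] up by blast
    then show "simple_reflection X i \<beta> \<in> fst ` set (entries_of_coeffs X L)"
      unfolding R c(2) simple_reflection_comb[OF i lenR[OF c(1)]] by blast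
  }
qed

end

definition cartan_G2 :: "int list list" where
  "cartan_G2 = [[2, -3], [-1, 2]]"

definition cartan_F4 :: "int list list" where
  "cartan_F4 = [[2, -1, 0, 0], [-1, 2, -1, 0], [0, -2, 2, -1], [0, 0, -1, 2]]"

definition cartan_E8 :: "int list list" where
  "cartan_E8 = [
     [2, 0, -1, 0, 0, 0, 0, 0],
     [0, 2, 0, -1, 0, 0, 0, 0],
     [-1, 0, 2, -1, 0, 0, 0, 0],
     [0, -1, -1, 2, -1, 0, 0, 0],
     [0, 0, 0, -1, 2, -1, 0, 0],
     [0, 0, 0, 0, -1, 2, -1, 0],
     [0, 0, 0, 0, 0, -1, 2, -1],
     [0, 0, 0, 0, 0, 0, -1, 2]]"

text \<open>Evaluating the membership of some hundreds of lists in a long literal list by rewriting is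
  slow, because every step traverses that literal again. The opaque predicate \<open>Q\<close> lets the
  evaluation compute both lists and stop there. Its defining equation then turns the entries of
  \<open>xs\<close> into rewrite rules that settle those of \<open>ys\<close> one at a time.\<close>

lemma subset_by_evaluation:
  assumes "\<And>Q :: 'a list \<Rightarrow> 'a list \<Rightarrow> bool.
    (\<And>R N. Q R N \<longleftrightarrow> (\<forall>P. list_all P R \<longrightarrow> list_all P N)) \<Longrightarrow> Q xs ys"
  shows "set ys \<subseteq> set xs"
proof -
  have "\<forall>P. list_all P xs \<longrightarrow> list_all P ys" by (rule assms) (rule refl)
  then have "list_all (\<lambda>x. x \<in> set xs) xs \<longrightarrow> list_all (\<lambda>x. x \<in> set xs) ys" by blast
  then show ?thesis by (auto simp: list_all_iff)
qed

lemma complete_G2: "complete_coeff_list cartan_G2 2 list_G2"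
  by code_simp

lemma upward_closed_G2:
  "set (upward_neighbours cartan_G2 2 (coeffs list_G2)) \<subseteq> set (coeffs list_G2)"
proof (rule subset_by_evaluation)
  fix Q :: "int list list \<Rightarrow> int list list \<Rightarrow> bool"
  assume Q: "\<And>R N. Q R N \<longleftrightarrow> (\<forall>P. list_all P R \<longrightarrow> list_all P N)"
  show "Q (coeffs list_G2) (upward_neighbours cartan_G2 2 (coeffs list_G2))"
    by code_simp (simp add: Q)
qed

lemma complete_F4: "complete_coeff_list cartan_F4 4 list_F4"
  by code_simp

lemma upward_closed_F4:
  "set (upward_neighbours cartan_F4 4 (coeffs list_F4)) \<subseteq> set (coeffs list_F4)"
proof (rule subset_by_evaluation)
  fix Q :: "int list list \<Rightarrow> int list list \<Rightarrow> bool"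
  assume Q: "\<And>R N. Q R N \<longleftrightarrow> (\<forall>P. list_all P R \<longrightarrow> list_all P N)"
  show "Q (coeffs list_F4) (upward_neighbours cartan_F4 4 (coeffs list_F4))"
    by code_simp (simp add: Q)
qed

lemma complete_E6: "complete_coeff_list cartan_E8 6 list_E6"
  by code_simp

lemma upward_closed_E6:
  "set (upward_neighbours cartan_E8 6 (coeffs list_E6)) \<subseteq> set (coeffs list_E6)"
proof (rule subset_by_evaluation)
  fix Q :: "int list list \<Rightarrow> int list list \<Rightarrow> bool"
  assume Q: "\<And>R N. Q R N \<longleftrightarrow> (\<forall>P. list_all P R \<longrightarrow> list_all P N)"
  show "Q (coeffs list_E6) (upward_neighbours cartan_E8 6 (coeffs list_E6))"
    by code_simp (simp add: Q)
qed

lemma complete_E7: "complete_coeff_list cartan_E8 7 list_E7"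
  by code_simp

lemma upward_closed_E7:
  "set (upward_neighbours cartan_E8 7 (coeffs list_E7)) \<subseteq> set (coeffs list_E7)"
proof (rule subset_by_evaluation)
  fix Q :: "int list list \<Rightarrow> int list list \<Rightarrow> bool"
  assume Q: "\<And>R N. Q R N \<longleftrightarrow> (\<forall>P. list_all P R \<longrightarrow> list_all P N)"
  show "Q (coeffs list_E7) (upward_neighbours cartan_E8 7 (coeffs list_E7))"
    by code_simp (simp add: Q)
qed

lemma complete_E8: "complete_coeff_list cartan_E8 8 list_E8"
  by code_simp

lemma upward_closed_E8:
  "set (upward_neighbours cartan_E8 8 (coeffs list_E8)) \<subseteq> set (coeffs list_E8)"
proof (rule subset_by_evaluation)
  fix Q :: "int list list \<Rightarrow> int list list \<Rightarrow> bool"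
  assume Q: "\<And>R N. Q R N \<longleftrightarrow> (\<forall>P. list_all P R \<longrightarrow> list_all P N)"
  show "Q (coeffs list_E8) (upward_neighbours cartan_E8 8 (coeffs list_E8))"
    by code_simp (simp add: Q)
qed

lemma nat_interval_insert:
  "{1..2::nat} = {1, 2}" "{1..4::nat} = {1, 2, 3, 4}" "{1..8::nat} = {1, 2, 3, 4, 5, 6, 7, 8}"
  by auto

lemma cartan_type_G2: "cartan_type Type_G2 cartan_G2"
proof -
  have "\<forall>i\<in>{1..2}. \<forall>j\<in>{1..2}. simple_root Type_G2 i \<in> carrier_vec 3 \<and>
      simple_root Type_G2 i \<bullet> simple_root Type_G2 i > 0 \<and>
      2 * (simple_root Type_G2 i \<bullet> simple_root Type_G2 j) =
        of_int (cartan_G2 ! (i - 1) ! (j - 1)) * (simple_root Type_G2 i \<bullet> simple_root Type_G2 i) \<and>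
      2 \<le> length (cartan_G2 ! (i - 1))"
    unfolding nat_interval_insert
    by (simp add: scalar_prod_linear[of _ 3] scalar_prod_e cartan_G2_def)
  then show ?thesis by unfold_locales auto
qed

lemma cartan_type_F4: "cartan_type Type_F4 cartan_F4"
proof -
  have "\<forall>i\<in>{1..4}. \<forall>j\<in>{1..4}. simple_root Type_F4 i \<in> carrier_vec 4 \<and>
      simple_root Type_F4 i \<bullet> simple_root Type_F4 i > 0 \<and>
      2 * (simple_root Type_F4 i \<bullet> simple_root Type_F4 j) =
        of_int (cartan_F4 ! (i - 1) ! (j - 1)) * (simple_root Type_F4 i \<bullet> simple_root Type_F4 i) \<and>
      4 \<le> length (cartan_F4 ! (i - 1))"
    unfolding nat_interval_insert
    by (simp add: scalar_prod_linear[of _ 4] scalar_prod_e cartan_F4_def)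
  then show ?thesis by unfold_locales auto
qed

lemma cartan_type_E:
  assumes "X \<in> {Type_E6, Type_E7, Type_E8}" shows "cartan_type X cartan_E8"
proof -
  have E8: "\<forall>i\<in>{1..8}. \<forall>j\<in>{1..8}. simple_root_E8 i \<in> carrier_vec 8 \<and>
      simple_root_E8 i \<bullet> simple_root_E8 i > 0 \<and>
      2 * (simple_root_E8 i \<bullet> simple_root_E8 j) =
        of_int (cartan_E8 ! (i - 1) ! (j - 1)) * (simple_root_E8 i \<bullet> simple_root_E8 i) \<and>
      8 \<le> length (cartan_E8 ! (i - 1))"
    unfolding nat_interval_insert
    by (simp add: simple_root_E8_def scalar_prod_linear[of _ 8] scalar_prod_e cartan_E8_def)
  have X: "simple_root X = simple_root_E8" "ambient_dim X = 8" "weyl_rank X \<le> 8"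
    using assms by auto
  have le: "i \<in> {1..8}" if "i \<in> {1..weyl_rank X}" for i using that X(3) by simp
  show ?thesis
    by unfold_locales (use E8 X le in \<open>force+\<close>)
qed

section \<open>All types\<close>

theorem theorem1p1:
  fixes X :: weyl_type and \<Phi> :: "real vec set"
  assumes "valid_type X"
    and "root_system X \<Phi>" and "irreducible_roots \<Phi>" and "has_simple_roots X \<Phi>"
  shows "(\<forall>(\<alpha>, u) \<in> set (reflection_list X).
            word_prod X u = root_reflection X \<alpha> \<and> palindromic u \<and>
            reduced_expression X u (root_reflection X \<alpha>)) \<and>
         (distinct (map fst (reflection_list X)) \<and>
          set (map fst (reflection_list X)) = positive_roots X \<Phi>) \<and>
         (distinct (map (\<lambda>(\<alpha>, u). root_reflection X \<alpha>) (reflection_list X)) \<and>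
          set (map (\<lambda>(\<alpha>, u). root_reflection X \<alpha>) (reflection_list X)) = reflections X)"
proof -
  have sys: "simple_system X \<Phi>" using assms by (intro simple_system.intro)
  show ?thesis
  proof (cases X)
    case (Type_A n)
    show ?thesis
      using type_A[OF sys[unfolded Type_A]] unfolding Type_A reflection_list.simps .
  next
    case (Type_B n)
    then have n: "n \<ge> 2" using assms(1) by simp
    show ?thesis
      using coordinate_type_BC.type_BC[OF coordinate_type_B[OF n] sys[unfolded Type_B]]
      unfolding Type_B reflection_list.simps list_BC_B[OF n] .
  next
    case (Type_C n)
    then have n: "n \<ge> 2" using assms(1) by simp
    show ?thesis
      using coordinate_type_BC.type_BC[OF coordinate_type_C[OF n] sys[unfolded Type_C]]
      unfolding Type_C reflection_list.simps list_BC_C[OF n] .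
  next
    case (Type_D n)
    then have n: "n \<ge> 4" using assms(1) by simp
    show ?thesis
      using coordinate_type_D.type_D[OF coordinate_type_D[OF n] sys[unfolded Type_D]]
      unfolding Type_D reflection_list.simps .
  next
    case Type_E6
    have "cartan_type Type_E6 cartan_E8" by (rule cartan_type_E) simp
    note cartan_type.complete_coeff_list_criterion[OF this sys[unfolded Type_E6],
        unfolded weyl_rank.simps, OF complete_E6 upward_closed_E6]
    then show ?thesis unfolding Type_E6 reflection_list.simps .
  next
    case Type_E7
    have "cartan_type Type_E7 cartan_E8" by (rule cartan_type_E) simp
    note cartan_type.complete_coeff_list_criterion[OF this sys[unfolded Type_E7],
        unfolded weyl_rank.simps, OF complete_E7 upward_closed_E7]
    then show ?thesis unfolding Type_E7 reflection_list.simps .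
  next
    case Type_E8
    have "cartan_type Type_E8 cartan_E8" by (rule cartan_type_E) simp
    note cartan_type.complete_coeff_list_criterion[OF this sys[unfolded Type_E8],
        unfolded weyl_rank.simps, OF complete_E8 upward_closed_E8]
    then show ?thesis unfolding Type_E8 reflection_list.simps .
  next
    case Type_F4
    note cartan_type.complete_coeff_list_criterion[OF cartan_type_F4 sys[unfolded Type_F4],
        unfolded weyl_rank.simps, OF complete_F4 upward_closed_F4]
    then show ?thesis unfolding Type_F4 reflection_list.simps .
  next
    case Type_G2
    note cartan_type.complete_coeff_list_criterion[OF cartan_type_G2 sys[unfolded Type_G2],
        unfolded weyl_rank.simps, OF complete_G2 upward_closed_G2]
    then show ?thesis unfolding Type_G2 reflection_list.simps .
  qed
qed

end
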